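(* Consider $\min_{\mathbf{x}\in\mathbb{R}^n}\max_{\mathbf{y}\in\mathbb{R}^m}F(\mathbf{x})+H(\mathbf{x},\mathbf{y})-G(\mathbf{y})$ with $H(\mathbf{x},\mathbf{y})=\mathbf{x}^\top\mathbf{B}\mathbf{y}-\mathbf{x}^\top\mathbf{u}_{\mathbf{x}}+\mathbf{u}_{\mathbf{y}}^\top\mathbf{y}$, under the assumptions in the context, with unique saddle point $(\boldsymbol{\omega}_{\mathbf{x}}^\star,\boldsymbol{\omega}_{\mathbf{y}}^\star)$. Set $$L_{\mathrm{Str}}=L_F\vee\left(\tfrac{\mu_F}{\mu_G}L_G\right)-\mu_F,\quad L_{\mathrm{Bil}}=\sqrt{\lambda_{\max}(\mathbf{B}^\top\mathbf{B})\cdot\tfrac{\mu_F}{\mu_G}+\mu_F^2},\quad \mu_\star=\mu_F,\quad \mathcal{R}=\tfrac{\mu_G}{\mu_F}.$$ Fix $r\in(0,1)$ and $\beta\in(0,\infty)$ arbitrarily, let $\sigma=\frac{1}{\sqrt3}\sqrt{\frac{1}{1-r}\sigma_{\mathrm{Str}}^2+(2+\frac1\beta)\sigma_{\mathrm{Bil}}^2}$, and choose stepsizes $\alpha_t\in(0,\bar\alpha(r,\beta)]$ and $\eta_t=\frac{\alpha_t}{\mu_\star}$, where $$\bar\alpha(r,\beta)=\frac{r}{1+\sqrt{1+r\left(\frac{L_{\mathrm{Str}}}{\mu_\star}+\frac{(1+\beta)L_{\mathrm{Bil}}^2}{\mu_\star^2}\right)}}.$$ Then the iterates of the direct stochastic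 AG-EG algorithm (see context), started at a fixed $[\mathbf{x}_0;\mathbf{y}_0]$, satisfy for all $t=1,\dots,\mathscr{T}$ $$\mathbb{E}\left[\|\mathbf{x}_t-\boldsymbol{\omega}_{\mathbf{x}}^\star\|^2+\mathcal{R}\|\mathbf{y}_t-\boldsymbol{\omega}_{\mathbf{y}}^\star\|^2\right]\le\left[\|\mathbf{x}_0-\boldsymbol{\omega}_{\mathbf{x}}^\star\|^2+\mathcal{R}\|\mathbf{y}_0-\boldsymbol{\omega}_{\mathbf{y}}^\star\|^2\right]\left(\tfrac{L_{\mathrm{Str}}}{\mu_\star}+1\right)\prod_{\tau=1}^t(1-\alpha_\tau)+\frac{3\sigma^2}{\mu_\star^2}\sum_{\tau=1}^t\alpha_\tau^2\prod_{\tau'=\tau+1}^t(1-\alpha_{\tau'}).$$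
   Context: Norms are Euclidean; $a\vee b=\max(a,b)$; $\lambda_{\max}$ is the largest eigenvalue. Assumptions. $F:\mathbb{R}^n\to\mathbb{R}$ is differentiable, $L_F$-smooth and $\mu_F$-strongly convex: $\frac{\mu_F}{2}\|\mathbf{x}-\mathbf{x}'\|^2\le F(\mathbf{x})-F(\mathbf{x}')-\nabla F(\mathbf{x}')^\top(\mathbf{x}-\mathbf{x}')\le\frac{L_F}{2}\|\mathbf{x}-\mathbf{x}'\|^2$; likewise $G:\mathbb{R}^m\to\mathbb{R}$ is $L_G$-smooth and $\mu_G$-strongly convex; $\mu_F,\mu_G>0$. $\mathbf{B}\in\mathbb{R}^{n\times m}$ with $n\ge m$ (without loss of generality). There are distributions $\mathcal{D}_\xi,\mathcal{D}_\zeta$ and stochastic gradients $\nabla f(\mathbf{x};\xi),\nabla g(\mathbf{y};\xi),\nabla_{\mathbf{x}}h(\mathbf{x},\mathbf{y};\zeta),\nabla_{\mathbf{y}}h(\mathbf{x},\mathbf{y};\zeta)$ that for all $\mathbf{x},\mathbf{y}$ are unbiased for $\nabla F(\mathbf{x}),\nabla G(\mathbf{y}),\nabla_{\mathbf{x}}H(\mathbf{x},\mathbf{y}),\nabla_{\mathbf{y}}H(\mathbf{x},\mathbf{y})$ and satisfy $\mathbb{E}_\xi[\|\nabla f(\mathbf{x};\xi)-\nabla F(\mathbf{x})\|^2+\frac{1}{\mathcal{R}}\|\nabla g(\mathbf{y};\xi)-\nabla G(\mathbf{y})\|^2]\le\sigma_{\mathrm{Str}}^2$ and $\mathbb{E}_\zeta[\|\nabla_{\mathbf{x}}h-\nabla_{\mathbf{x}}H\|^2+\frac{1}{\mathcal{R}}\|\nabla_{\mathbf{y}}h-\nabla_{\mathbf{y}}H\|^2]\le\sigma_{\mathrm{Bil}}^2$.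 A saddle point satisfies $\mathscr{F}(\boldsymbol{\omega}_{\mathbf{x}}^\star,\mathbf{y})\le\mathscr{F}(\boldsymbol{\omega}_{\mathbf{x}}^\star,\boldsymbol{\omega}_{\mathbf{y}}^\star)\le\mathscr{F}(\mathbf{x},\boldsymbol{\omega}_{\mathbf{y}}^\star)$ for all $\mathbf{x},\mathbf{y}$, where $\mathscr{F}=F+H-G$. Direct stochastic AG-EG algorithm: set $\mathbf{x}^{\mathrm{ag}}_{-1/2}=\mathbf{x}^{\mathrm{md}}_0=\mathbf{x}_0$, $\mathbf{y}^{\mathrm{ag}}_{-1/2}=\mathbf{y}^{\mathrm{md}}_0=\mathbf{y}_0$. For $t=1,\dots,\mathscr{T}$ draw $\xi_{t-\frac12}\sim\mathcal{D}_\xi$ and $\zeta_{t-\frac12},\zeta_t\sim\mathcal{D}_\zeta$ (all samples independent of each other and of the past) and set $\mathbf{x}_{t-\frac12}=\mathbf{x}_{t-1}-\eta_t(\nabla f(\mathbf{x}^{\mathrm{md}}_{t-1};\xi_{t-\frac12})+\nabla_{\mathbf{x}}h(\mathbf{x}_{t-1},\mathbf{y}_{t-1};\zeta_{t-\frac12})-\mu_F(\mathbf{x}^{\mathrm{md}}_{t-1}-\mathbf{x}_{t-1}))$, $\mathbf{y}_{t-\frac12}=\mathbf{y}_{t-1}-\frac{\eta_t}{\mathcal{R}}(-\nabla_{\mathbf{y}}h(\mathbf{x}_{t-1},\mathbf{y}_{t-1};\zeta_{t-\frac12})+\nabla g(\mathbf{y}^{\mathrm{md}}_{t-1};\xi_{t-\frac12})-\mu_G(\mathbf{y}^{\mathrm{md}}_{t-1}-\mathbf{y}_{t-1}))$,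 $\mathbf{x}^{\mathrm{ag}}_{t-\frac12}=(1-\alpha_t)\mathbf{x}^{\mathrm{ag}}_{t-\frac32}+\alpha_t\mathbf{x}_{t-\frac12}$, $\ \mathbf{y}^{\mathrm{ag}}_{t-\frac12}=(1-\alpha_t)\mathbf{y}^{\mathrm{ag}}_{t-\frac32}+\alpha_t\mathbf{y}_{t-\frac12}$, $\mathbf{x}_t=\mathbf{x}_{t-1}-\eta_t(\nabla f(\mathbf{x}^{\mathrm{md}}_{t-1};\xi_{t-\frac12})+\nabla_{\mathbf{x}}h(\mathbf{x}_{t-\frac12},\mathbf{y}_{t-\frac12};\zeta_t)-\mu_F(\mathbf{x}^{\mathrm{md}}_{t-1}-\mathbf{x}_{t-\frac12}))$, $\mathbf{y}_t=\mathbf{y}_{t-1}-\frac{\eta_t}{\mathcal{R}}(-\nabla_{\mathbf{y}}h(\mathbf{x}_{t-\frac12},\mathbf{y}_{t-\frac12};\zeta_t)+\nabla g(\mathbf{y}^{\mathrm{md}}_{t-1};\xi_{t-\frac12})-\mu_G(\mathbf{y}^{\mathrm{md}}_{t-1}-\mathbf{y}_{t-\frac12}))$, $\mathbf{x}^{\mathrm{md}}_t=(1-\alpha_{t+1})\mathbf{x}^{\mathrm{ag}}_{t-\frac12}+\alpha_{t+1}\mathbf{x}_t$, $\ \mathbf{y}^{\mathrm{md}}_t=(1-\alpha_{t+1})\mathbf{y}^{\mathrm{ag}}_{t-\frac12}+\alpha_{t+1}\mathbf{y}_t$. The output is $[\mathbf{x}_{\mathscr{T}};\mathbf{y}_{\mathscr{T}}]$.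 An empty product equals $1$. *)

theory Defs
  imports "HOL-Probability.Probability"
begin

definition grad :: "('a::real_inner \<Rightarrow> real) \<Rightarrow> 'a \<Rightarrow> 'a" where
  "grad F x = (THE D. GDERIV F x :> D)"

definition smooth_strongly_convex :: "real \<Rightarrow> real \<Rightarrow> ('a::real_inner \<Rightarrow> real) \<Rightarrow> bool" where
  "smooth_strongly_convex L \<mu> F \<longleftrightarrow>
     (\<forall>x. F differentiable (at x)) \<and>
     (\<forall>x x'. \<mu> / 2 * (norm (x - x'))\<^sup>2 \<le> F x - F x' - grad F x' \<bullet> (x - x') \<and>
             F x - F x' - grad F x' \<bullet> (x - x') \<le> L / 2 * (norm (x - x'))\<^sup>2)"

definition lambda_max :: "real^'n^'n \<Rightarrow> real" where
  "lambda_max A = Max {l. \<exists>v. v \<noteq> 0 \<and> A *v v = l *\<^sub>R v}"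

definition bilinear_coupling ::
    "real^'m^'n \<Rightarrow> real^'n \<Rightarrow> real^'m \<Rightarrow> real^'n \<Rightarrow> real^'m \<Rightarrow> real" where
  "bilinear_coupling B ux uy x y = x \<bullet> (B *v y) - x \<bullet> ux + uy \<bullet> y"

definition saddle_point :: "('a \<Rightarrow> 'b \<Rightarrow> real) \<Rightarrow> 'a \<Rightarrow> 'b \<Rightarrow> bool" where
  "saddle_point \<Phi> wx wy \<longleftrightarrow> (\<forall>x y. \<Phi> wx y \<le> \<Phi> wx wy \<and> \<Phi> wx wy \<le> \<Phi> x wy)"

definition alpha_bar :: "real \<Rightarrow> real \<Rightarrow> real \<Rightarrow> real \<Rightarrow> real \<Rightarrow> real" where
  "alpha_bar LStr LBil \<mu> r \<beta> =
     r / (1 + sqrt (1 + r * (LStr / \<mu> + (1 + \<beta>) * LBil\<^sup>2 / \<mu>\<^sup>2)))"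

(* State after t iterations: x_t, y_t, x^ag_(t-1/2), y^ag_(t-1/2), x^md_t, y^md_t. *)
record ('a, 'b) ageg_state =
  st_x :: 'a
  st_y :: 'b
  st_xag :: 'a
  st_yag :: 'b
  st_xmd :: 'a
  st_ymd :: 'b

(* One iteration t. The arguments \<eta>, \<alpha>, \<alpha>' stand for eta_t, alpha_t, alpha_(t+1), and
   \<xi>, \<zeta>, \<zeta>' for the samples xi_(t-1/2), zeta_(t-1/2), zeta_t. The stochastic gradients
   nf, ng, hx, hy are those of F, of G, and of the coupling H in x and in y. *)
definition ageg_step ::
    "('a::real_vector \<Rightarrow> 's \<Rightarrow> 'a) \<Rightarrow> ('b::real_vector \<Rightarrow> 's \<Rightarrow> 'b) \<Rightarrow>
     ('a \<Rightarrow> 'b \<Rightarrow> 'z \<Rightarrow> 'a) \<Rightarrow> ('a \<Rightarrow> 'b \<Rightarrow> 'z \<Rightarrow> 'b) \<Rightarrow> real \<Rightarrow> real \<Rightarrow> real \<Rightarrow>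
     real \<Rightarrow> real \<Rightarrow> real \<Rightarrow> 's \<Rightarrow> 'z \<Rightarrow> 'z \<Rightarrow> ('a, 'b) ageg_state \<Rightarrow> ('a, 'b) ageg_state" where
  "ageg_step nf ng hx hy \<mu>F \<mu>G R \<eta> \<alpha> \<alpha>' \<xi> \<zeta> \<zeta>' S =
     (let x = st_x S; y = st_y S; xmd = st_xmd S; ymd = st_ymd S;
          xh = x - \<eta> *\<^sub>R (nf xmd \<xi> + hx x y \<zeta> - \<mu>F *\<^sub>R (xmd - x));
          yh = y - (\<eta> / R) *\<^sub>R (- hy x y \<zeta> + ng ymd \<xi> - \<mu>G *\<^sub>R (ymd - y));
          xag = (1 - \<alpha>) *\<^sub>R st_xag S + \<alpha> *\<^sub>R xh;
          yag = (1 - \<alpha>) *\<^sub>R st_yag S + \<alpha> *\<^sub>R yh;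
          x' = x - \<eta> *\<^sub>R (nf xmd \<xi> + hx xh yh \<zeta>' - \<mu>F *\<^sub>R (xmd - xh));
          y' = y - (\<eta> / R) *\<^sub>R (- hy xh yh \<zeta>' + ng ymd \<xi> - \<mu>G *\<^sub>R (ymd - yh))
      in \<lparr>st_x = x', st_y = y', st_xag = xag, st_yag = yag,
          st_xmd = (1 - \<alpha>') *\<^sub>R xag + \<alpha>' *\<^sub>R x',
          st_ymd = (1 - \<alpha>') *\<^sub>R yag + \<alpha>' *\<^sub>R y'\<rparr>)"

(* \<xi> t, \<zeta>h t, \<zeta> t are the realised samples xi_(t-1/2), zeta_(t-1/2), zeta_t. *)
primrec ageg ::
    "('a::real_vector \<Rightarrow> 's \<Rightarrow> 'a) \<Rightarrow> ('b::real_vector \<Rightarrow> 's \<Rightarrow> 'b) \<Rightarrow>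
     ('a \<Rightarrow> 'b \<Rightarrow> 'z \<Rightarrow> 'a) \<Rightarrow> ('a \<Rightarrow> 'b \<Rightarrow> 'z \<Rightarrow> 'b) \<Rightarrow> real \<Rightarrow> real \<Rightarrow> real \<Rightarrow>
     (nat \<Rightarrow> real) \<Rightarrow> (nat \<Rightarrow> real) \<Rightarrow> (nat \<Rightarrow> 's) \<Rightarrow> (nat \<Rightarrow> 'z) \<Rightarrow> (nat \<Rightarrow> 'z) \<Rightarrow>
     'a \<Rightarrow> 'b \<Rightarrow> nat \<Rightarrow> ('a, 'b) ageg_state" where
  "ageg nf ng hx hy \<mu>F \<mu>G R \<eta> \<alpha> \<xi> \<zeta>h \<zeta> x0 y0 0 =
     \<lparr>st_x = x0, st_y = y0, st_xag = x0, st_yag = y0, st_xmd = x0, st_ymd = y0\<rparr>"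
| "ageg nf ng hx hy \<mu>F \<mu>G R \<eta> \<alpha> \<xi> \<zeta>h \<zeta> x0 y0 (Suc k) =
     ageg_step nf ng hx hy \<mu>F \<mu>G R (\<eta> (Suc k)) (\<alpha> (Suc k)) (\<alpha> (Suc (Suc k)))
       (\<xi> (Suc k)) (\<zeta>h (Suc k)) (\<zeta> (Suc k))
       (ageg nf ng hx hy \<mu>F \<mu>G R \<eta> \<alpha> \<xi> \<zeta>h \<zeta> x0 y0 k)"

datatype sample_index = Xi_half nat | Zeta_half nat | Zeta_full nat

(* The samples drawn in iterations 1, ..., T have laws D\<xi>, D\<zeta>, D\<zeta> and are mutually
   independent. This is stated through the generated sigma-algebras, exactly as in the definition
   of indep_vars, because indep_vars requires a common value type for all variables. *)
definition independent_samples ::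
    "'w measure \<Rightarrow> 's measure \<Rightarrow> 'z measure \<Rightarrow> nat \<Rightarrow>
     (nat \<Rightarrow> 'w \<Rightarrow> 's) \<Rightarrow> (nat \<Rightarrow> 'w \<Rightarrow> 'z) \<Rightarrow> (nat \<Rightarrow> 'w \<Rightarrow> 'z) \<Rightarrow> bool" where
  "independent_samples M D\<xi> D\<zeta> T \<xi> \<zeta>h \<zeta> \<longleftrightarrow>
     (\<forall>t\<in>{1..T}. \<xi> t \<in> M \<rightarrow>\<^sub>M D\<xi> \<and> distr M D\<xi> (\<xi> t) = D\<xi> \<and>
                 \<zeta>h t \<in> M \<rightarrow>\<^sub>M D\<zeta> \<and> distr M D\<zeta> (\<zeta>h t) = D\<zeta> \<and>
                 \<zeta> t \<in> M \<rightarrow>\<^sub>M D\<zeta> \<and> distr M D\<zeta> (\<zeta> t) = D\<zeta>) \<and>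
     prob_space.indep_sets M
       (\<lambda>i. case i of
          Xi_half t \<Rightarrow> {\<xi> t -` A \<inter> space M |A. A \<in> sets D\<xi>}
        | Zeta_half t \<Rightarrow> {\<zeta>h t -` A \<inter> space M |A. A \<in> sets D\<zeta>}
        | Zeta_full t \<Rightarrow> {\<zeta> t -` A \<inter> space M |A. A \<in> sets D\<zeta>})
       (Xi_half ` {1..T} \<union> Zeta_half ` {1..T} \<union> Zeta_full ` {1..T})"

end

theory Submission
  imports Defs
begin

text \<open>
  In the coordinates \<open>z = (x, sqrt R y)\<close> both blocks have strong convexity modulus \<open>\<mu>\<close>. Moving the
  quadratic \<open>\<mu>/2 |z|\<^sup>2\<close> from the objective to the coupling leaves a convex \<open>LStr\<close>-smooth function \<open>f\<close>
  and an operator \<open>W\<close>, \<open>\<mu>\<close> times the identity plus a skew affine map, which is \<open>\<mu>\<close>-strongly monotone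
  and \<open>LBil\<close>-Lipschitz. With \<open>V\<close> the Bregman divergence of \<open>f\<close> from the saddle point \<open>zs\<close>, the
  Lyapunov function \<open>|z - zs|\<^sup>2 + (2/\<mu>) V(ag)\<close> contracts by \<open>1 - \<alpha>\<close> in expectation, up to
  \<open>3 \<sigma>\<^sup>2 \<alpha>\<^sup>2 / \<mu>\<^sup>2\<close>: the extragradient identity produces \<open>- |zh - z|\<^sup>2\<close>, where \<open>zh\<close> is the half step;
  a fraction \<open>r\<close> of it pays for the smoothness and Lipschitz errors (this is the stepsize condition)
  and the remaining \<open>1 - r\<close> for the correlation of \<open>zh\<close> with the gradient noise that both half steps
  share. Bounding the initial \<open>V\<close> by smoothness costs the factor \<open>LStr/\<mu> + 1\<close>.
\<close>

section \<open>The largest eigenvalue of a Gram matrix\<close>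

text \<open>Near 0 the linear term dominates. At \<open>t = - a / b\<close>, with \<open>b\<close>
  above both 0 and \<open>c\<close>, the expression equals
  \<open>a\<^sup>2 * (c - b) / b\<^sup>2\<close>, which is negative unless \<open>a\<close>
  vanishes.\<close>

lemma linear_coeff_zero:
  fixes a c :: real
  assumes "\<And>t. 0 \<le> t * a + t\<^sup>2 * c"
  shows "a = 0"
proof (rule ccontr)
  assume "a \<noteq> 0"
  define b where "b = \<bar>c\<bar> + 1"
  have b: "b > 0" "c < b" by (auto simp: b_def)
  have "0 \<le> - a / b * a + (- a / b)\<^sup>2 * c" by (rule assms)
  also have "\<dots> = a\<^sup>2 * (c - b) / b\<^sup>2"
    using b by (simp add: divide_simps power2_eq_square algebra_simps)
  also have "\<dots> < 0" using b \<open>a \<noteq> 0\<close> by (intro divide_neg_pos mult_pos_neg) auto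
  finally show False by simp
qed

text \<open>First-order optimality with a quadratic remainder: testing along multiples of
  \<open>p\<close> itself reduces it to the scalar case. It serves to extract stationarity from the
  saddle inequalities.\<close>

lemma zero_if_quadratic_nonneg:
  fixes p :: "'a::real_inner"
  assumes "\<And>d. 0 \<le> p \<bullet> d + c * (norm d)\<^sup>2"
  shows "p = 0"
proof -
  have "0 \<le> t * (p \<bullet> p) + t\<^sup>2 * (c * (norm p)\<^sup>2)" for t
    using assms[of "t *\<^sub>R p"] by (simp add: power_mult_distrib mult_ac)
  then have "p \<bullet> p = 0" by (rule linear_coeff_zero)
  then show ?thesis by simp
qed

lemma inner_gram_mult_vec:
  fixes B :: "real^'m^'n"
  shows "v \<bullet> ((transpose B ** B) *v w) = (B *v v) \<bullet> (B *v w)"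
  by (metis dot_lmul_matrix inner_commute matrix_vector_mul_assoc vector_transpose_matrix)

text \<open>\<open>lambda_max\<close> is a \<open>Max\<close>, so finiteness is needed before an
  eigenvalue can be compared with it. Eigenvectors of a symmetric matrix for distinct eigenvalues
  are orthogonal, and a pairwise orthogonal set of vectors is finite.\<close>

lemma finite_eigenvalues_gram:
  fixes B :: "real^'m^'n"
  shows "finite {l. \<exists>v. v \<noteq> 0 \<and> (transpose B ** B) *v v = l *\<^sub>R v}" (is "finite ?E")
proof -
  let ?A = "transpose B ** B"
  obtain v where v: "\<And>l. l \<in> ?E \<Longrightarrow> v l \<noteq> 0 \<and> ?A *v v l = l *\<^sub>R v l"
    using bchoice[of ?E "\<lambda>l v. v \<noteq> 0 \<and> ?A *v v = l *\<^sub>R v"] by blast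
  have orth: "orthogonal (v l) (v k)" if "l \<in> ?E" "k \<in> ?E" "l \<noteq> k" for l k
  proof -
    have "v l \<bullet> (?A *v v k) = v k \<bullet> (?A *v v l)"
      unfolding inner_gram_mult_vec by (rule inner_commute)
    then have "k * (v l \<bullet> v k) = l * (v l \<bullet> v k)"
      using v that by (simp add: inner_commute)
    then show ?thesis using that by (simp add: orthogonal_def)
  qed
  \<comment> \<open>A vector chosen for two distinct eigenvalues would be orthogonal to itself,
    hence 0.\<close>
  have "inj_on v ?E"
  proof (rule inj_onI, rule ccontr)
    fix l k assume "l \<in> ?E" "k \<in> ?E" "v l = v k" "l \<noteq> k"
    with orth[of l k] v[of k] show False by (simp add: orthogonal_self)
  qed
  moreover have "pairwise orthogonal (v ` ?E)"
    using orth by (auto simp: pairwise_def)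
  then have "finite (v ` ?E)" by (rule pairwise_orthogonal_imp_finite)
  ultimately show ?thesis by (rule finite_imageD[rotated])
qed

text \<open>Variational characterisation: compactness gives a maximiser \<open>u\<close> of
  \<open>norm (B *v w)\<close> on the unit sphere. The squared maximum \<open>l\<close> bounds the
  quadratic form by homogeneity, and \<open>u\<close> turns out to be an eigenvector for
  \<open>l\<close>.\<close>

lemma norm_mult_vec_le_lambda_max:
  fixes B :: "real^'m^'n"
  shows "(norm (B *v v))\<^sup>2 \<le> lambda_max (transpose B ** B) * (norm v)\<^sup>2"
proof -
  let ?A = "transpose B ** B"
  let ?E = "{l. \<exists>v. v \<noteq> 0 \<and> ?A *v v = l *\<^sub>R v}"
  have "compact (sphere 0 1 :: (real^'m) set)" "sphere 0 1 \<noteq> ({} :: (real^'m) set)"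
    by auto
  moreover have "continuous_on (sphere 0 1) (\<lambda>v. (norm (B *v v))\<^sup>2)"
    by (intro continuous_intros)
  ultimately obtain u where u: "norm u = 1"
    and max: "\<And>w. norm w = 1 \<Longrightarrow> (norm (B *v w))\<^sup>2 \<le> (norm (B *v u))\<^sup>2"
    using continuous_attains_sup[of "sphere 0 1" "\<lambda>v. (norm (B *v v))\<^sup>2"] by auto
  define l where "l = (norm (B *v u))\<^sup>2"
  have bound: "(norm (B *v w))\<^sup>2 \<le> l * (norm w)\<^sup>2" for w
  proof (cases "w = 0")
    case False
    have "B *v w = norm w *\<^sub>R (B *v (w /\<^sub>R norm w))"
      using False by (simp add: matrix_vector_mult_scaleR)
    then have "(norm (B *v w))\<^sup>2 = (norm w)\<^sup>2 * (norm (B *v (w /\<^sub>R norm w)))\<^sup>2"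
      by (metis norm_scaleR power_mult_distrib power2_abs)
    also have "\<dots> \<le> (norm w)\<^sup>2 * l"
      unfolding l_def using False by (intro mult_left_mono max) auto
    finally show ?thesis by (simp add: mult.commute)
  qed simp
  \<comment> \<open>\<open>d = 0\<close> is the eigenvalue equation for \<open>u\<close>; perturbing
    \<open>u\<close> along \<open>d\<close> itself makes the linear coefficient
    \<open>2 * (d \<bullet> d)\<close>.\<close>
  define d where "d = l *\<^sub>R u - ?A *v u"
  \<comment> \<open>The nonnegative form \<open>w \<mapsto> l |w|\<^sup>2 - |B w|\<^sup>2\<close> vanishes at \<open>u\<close>, hence so does its gradient there.\<close>
  have quad: "0 \<le> 2 * t * (d \<bullet> d) + t\<^sup>2 * (l * (norm d)\<^sup>2 - (norm (B *v d))\<^sup>2)" for t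
  proof -
    have "(norm (B *v (u + t *\<^sub>R d)))\<^sup>2
        = l + 2 * t * ((B *v d) \<bullet> (B *v u)) + t\<^sup>2 * (norm (B *v d))\<^sup>2"
      unfolding l_def power2_norm_eq_inner
      by (simp add: matrix_vector_right_distrib matrix_vector_mult_scaleR inner_add_left
          inner_add_right inner_commute algebra_simps power2_eq_square)
    moreover have "(norm (u + t *\<^sub>R d))\<^sup>2 = 1 + 2 * t * (d \<bullet> u) + t\<^sup>2 * (norm d)\<^sup>2"
      using u unfolding power2_norm_eq_inner
      by (simp add: inner_add_left inner_add_right inner_commute algebra_simps power2_eq_square
          norm_eq_1)
    ultimately have "0 \<le> 2 * t * (l * (d \<bullet> u) - (B *v d) \<bullet> (B *v u))
        + t\<^sup>2 * (l * (norm d)\<^sup>2 - (norm (B *v d))\<^sup>2)"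
      using bound[of "u + t *\<^sub>R d"] by (simp add: algebra_simps)
    moreover have "d \<bullet> d = l * (d \<bullet> u) - (B *v d) \<bullet> (B *v u)"
      unfolding inner_gram_mult_vec[symmetric] by (subst (2) d_def) (simp add: inner_diff_right)
    ultimately show ?thesis by simp
  qed
  have "2 * (d \<bullet> d) = 0"
    using quad by (intro linear_coeff_zero[where c = "l * (norm d)\<^sup>2 - (norm (B *v d))\<^sup>2"])
      (simp add: mult_ac)
  then have "l \<in> ?E" using u by (auto simp: d_def intro!: exI[of _ u])
  then have "l \<le> lambda_max ?A"
    unfolding lambda_max_def by (intro Max_ge finite_eigenvalues_gram)
  with bound[of v] show ?thesis
    by (meson mult_right_mono order_trans zero_le_power2)
qed

lemma lambda_max_gram_nonneg:
  fixes B :: "real^'m^'n"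
  shows "0 \<le> lambda_max (transpose B ** B)"
proof -
  obtain v :: "real^'m" where "norm v = 1" using vector_choose_size zero_le_one by blast
  then show ?thesis using norm_mult_vec_le_lambda_max[of B v]
    by (metis mult.right_neutral order_trans power_one zero_le_power2)
qed

text \<open>The adjoint inherits the bound: with \<open>?w\<close> the image of \<open>x\<close>,
  \<open>(norm ?w)\<^sup>2 = x \<bullet> (B *v ?w)\<close>. Cauchy-Schwarz and the bound for
  \<open>B\<close> at \<open>?w\<close> then leave a factor \<open>(norm ?w)\<^sup>2\<close> to
  cancel.\<close>

lemma norm_transpose_mult_vec_le_lambda_max:
  fixes B :: "real^'m^'n"
  shows "(norm (transpose B *v x))\<^sup>2 \<le> lambda_max (transpose B ** B) * (norm x)\<^sup>2"
proof (cases "transpose B *v x = 0")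
  case False
  let ?w = "transpose B *v x" and ?l = "lambda_max (transpose B ** B)"
  have "(norm ?w)\<^sup>2 = x \<bullet> (B *v ?w)"
    by (metis dot_lmul_matrix power2_norm_eq_inner vector_transpose_matrix transpose_transpose)
  also have "\<dots> \<le> norm x * norm (B *v ?w)" by (rule norm_cauchy_schwarz)
  finally have "((norm ?w)\<^sup>2)\<^sup>2 \<le> (norm x * norm (B *v ?w))\<^sup>2"
    by (intro power_mono) auto
  also have "\<dots> \<le> (norm x)\<^sup>2 * (?l * (norm ?w)\<^sup>2)"
    unfolding power_mult_distrib by (intro mult_left_mono norm_mult_vec_le_lambda_max) simp
  finally have "(norm ?w)\<^sup>2 * (norm ?w)\<^sup>2 \<le> (?l * (norm x)\<^sup>2) * (norm ?w)\<^sup>2"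
    by (simp add: power2_eq_square mult_ac)
  then show ?thesis by (rule mult_right_le_imp_le) (use False in auto)
qed (simp add: lambda_max_gram_nonneg)

section \<open>One step of the algorithm with fixed noise\<close>

text \<open>Expand the nonnegative square of \<open>\<beta> *\<^sub>R a + b\<close> divided by
  \<open>\<beta>\<close>. The weight becomes the free \<open>\<beta>\<close> of the theorem, which
  divides the cost between the variation of the operator and the noise of the first coupling
  sample.\<close>

lemma power2_norm_diff_le:
  fixes a b :: "'a::real_inner"
  assumes "\<beta> > 0"
  shows "(norm (a - b))\<^sup>2 \<le> (1 + \<beta>) * (norm a)\<^sup>2 + (1 + 1 / \<beta>) * (norm b)\<^sup>2"
proof -
  have "0 \<le> (norm (\<beta> *\<^sub>R a + b))\<^sup>2 / \<beta>" using assms by simp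
  also have "\<dots> = \<beta> * (norm a)\<^sup>2 + 2 * (a \<bullet> b) + (norm b)\<^sup>2 / \<beta>"
    using assms unfolding power2_norm_eq_inner
    by (simp add: inner_add_left inner_add_right inner_commute field_simps)
  finally show ?thesis
    unfolding power2_norm_eq_inner
    by (simp add: inner_diff_left inner_diff_right inner_commute algebra_simps)
qed

text \<open>Lets a prescribed fraction \<open>c\<close> of one square absorb an inner product; it is
  applied with \<open>c = 1 - r\<close>.\<close>

lemma inner_young:
  fixes a b :: "'a::real_inner"
  assumes "c > 0"
  shows "- 2 * (a \<bullet> b) \<le> c * (norm b)\<^sup>2 + (norm a)\<^sup>2 / c"
proof -
  have "0 \<le> (norm (c *\<^sub>R b + a))\<^sup>2 / c" using assms by simp
  also have "\<dots> = c * (norm b)\<^sup>2 + 2 * (a \<bullet> b) + (norm a)\<^sup>2 / c"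
    using assms unfolding power2_norm_eq_inner
    by (simp add: inner_add_left inner_add_right inner_commute field_simps)
  finally show ?thesis by simp
qed

text \<open>Unrolling by induction; \<open>\<alpha> k \<le> 1\<close> makes the contraction factors
  nonnegative, so that the induction hypothesis may be multiplied by them.\<close>

lemma prod_recursion_bound:
  fixes a \<alpha> :: "nat \<Rightarrow> real"
  assumes "\<And>k. k < t \<Longrightarrow> a (Suc k) \<le> (1 - \<alpha> (Suc k)) * a k + c * (\<alpha> (Suc k))\<^sup>2"
    and "\<And>k. k \<in> {1..t} \<Longrightarrow> \<alpha> k \<le> 1"
  shows "a t \<le> a 0 * (\<Prod>\<tau>=1..t. 1 - \<alpha> \<tau>)
    + c * (\<Sum>\<tau>=1..t. (\<alpha> \<tau>)\<^sup>2 * (\<Prod>\<tau>'=\<tau>+1..t. 1 - \<alpha> \<tau>'))"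
  using assms
proof (induction t)
  case (Suc t)
  let ?S = "\<lambda>t. \<Sum>\<tau>=1..t. (\<alpha> \<tau>)\<^sup>2 * (\<Prod>\<tau>'=\<tau>+1..t. 1 - \<alpha> \<tau>')"
  let ?P = "\<lambda>t. \<Prod>\<tau>=1..t. 1 - \<alpha> \<tau>"
  \<comment> \<open>The summand for \<open>Suc t\<close> has an empty product and contributes only
    the squared step; every older summand gains one more factor.\<close>
  have "?S (Suc t) = (\<Sum>\<tau>=1..t. (\<alpha> \<tau>)\<^sup>2 * ((\<Prod>\<tau>'=\<tau>+1..t. 1 - \<alpha> \<tau>') * (1 - \<alpha> (Suc t)))) + (\<alpha> (Suc t))\<^sup>2"
    by simp
  then have S: "?S (Suc t) = (1 - \<alpha> (Suc t)) * ?S t + (\<alpha> (Suc t))\<^sup>2"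
    by (simp add: sum_distrib_left mult_ac)
  have "a (Suc t) \<le> (1 - \<alpha> (Suc t)) * a t + c * (\<alpha> (Suc t))\<^sup>2"
    using Suc.prems by simp
  also have "\<dots> \<le> (1 - \<alpha> (Suc t)) * (a 0 * ?P t + c * ?S t) + c * (\<alpha> (Suc t))\<^sup>2"
    using Suc by (intro add_right_mono mult_left_mono) auto
  also have "\<dots> = a 0 * ?P (Suc t) + c * ?S (Suc t)"
    unfolding S by (simp add: algebra_simps)
  finally show ?case .
qed simp

text \<open>The upper bound on \<open>\<alpha>\<close> is the positive root of
  \<open>\<alpha>\<^sup>2 * \<kappa> + 2 * \<alpha> = r\<close> with rationalised denominator, so
  that \<open>\<kappa> = 0\<close> is covered. The proof uses
  \<open>r * \<kappa> = (s + 1) * (s - 1)\<close> and multiplies by \<open>r\<close>, which avoids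
  dividing by \<open>\<kappa>\<close>.\<close>

lemma stepsize_condition:
  fixes \<alpha> r \<kappa> :: real
  assumes "0 \<le> \<kappa>" "0 < r" "0 < \<alpha>" "\<alpha> \<le> r / (1 + sqrt (1 + r * \<kappa>))"
  shows "\<alpha>\<^sup>2 * \<kappa> + 2 * \<alpha> \<le> r"
proof -
  define s where "s = sqrt (1 + r * \<kappa>)"
  have s: "s \<ge> 1" and s2: "s\<^sup>2 = 1 + r * \<kappa>" using assms by (auto simp: s_def)
  have \<alpha>s: "\<alpha> * (1 + s) \<le> r"
    using assms(4) s unfolding s_def[symmetric] by (simp add: pos_le_divide_eq)
  have "r * \<alpha> * (\<alpha> * \<kappa> + 2) = \<alpha> * (1 + s) * (\<alpha> * (s - 1)) + 2 * r * \<alpha>"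
    using s2 by (simp add: algebra_simps power2_eq_square)
  also have "\<dots> \<le> r * (\<alpha> * (s - 1)) + 2 * r * \<alpha>"
    using assms s \<alpha>s by (intro add_right_mono mult_right_mono) auto
  also have "\<dots> = r * (\<alpha> * (1 + s))" by (simp add: algebra_simps)
  also have "\<dots> \<le> r * r"
    using assms \<alpha>s by (intro mult_left_mono) auto
  finally have "r * (\<alpha>\<^sup>2 * \<kappa> + 2 * \<alpha>) \<le> r * r"
    by (simp add: power2_eq_square algebra_simps)
  then show ?thesis using \<open>0 < r\<close> by simp
qed

text \<open>Both steps start at \<open>z\<close>, so this is a plain expansion valid for arbitrary
  directions. Pairing \<open>g2\<close> with the half step instead of with \<open>z\<close> is what
  leaves a negative square.\<close>

lemma extragradient_identity:
  fixes z zs g1 g2 :: "'a::real_inner" and \<eta> :: real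
  defines "zh \<equiv> z - \<eta> *\<^sub>R g1"
  shows "(norm (z - \<eta> *\<^sub>R g2 - zs))\<^sup>2 = (norm (z - zs))\<^sup>2 - 2 * \<eta> * (g2 \<bullet> (zh - zs))
    + \<eta>\<^sup>2 * (norm (g2 - g1))\<^sup>2 - (norm (zh - z))\<^sup>2"
  unfolding power2_norm_eq_inner zh_def
  by (simp add: inner_diff_left inner_diff_right inner_commute algebra_simps power2_eq_square)

section \<open>Deterministic descent for a smooth convex part plus a strongly monotone
  operator\<close>

locale composite_operator =
  fixes f :: "'a::euclidean_space \<Rightarrow> real" and g W :: "'a \<Rightarrow> 'a" and L K \<mu> :: real and zs :: 'a
  assumes f_convex: "0 \<le> f z - f z' - g z' \<bullet> (z - z')"
    and f_smooth: "f z - f z' - g z' \<bullet> (z - z') \<le> L / 2 * (norm (z - z'))\<^sup>2"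
    and W_monotone: "\<mu> * (norm (z - z'))\<^sup>2 \<le> (W z - W z') \<bullet> (z - z')"
    and W_lipschitz: "norm (W z - W z') \<le> K * norm (z - z')"
    and zs_root: "g zs + W zs = 0"
    and \<mu>_pos: "0 < \<mu>"
begin

definition breg :: "'a \<Rightarrow> real" where
  "breg z = f z - f zs - g zs \<bullet> (z - zs)"

text \<open>The pair consists of the current and the aggregated point. The weight
  \<open>2 / \<mu>\<close> is chosen so that, with \<open>\<eta> = \<alpha> / \<mu>\<close>, the
  gradient term of \<open>breg_step\<close> becomes \<open>2 * \<eta>\<close> times the inner
  product that the extragradient identity subtracts, and the two cancel.\<close>

definition lyap :: "'a \<times> 'a \<Rightarrow> real" where
  "lyap p = (norm (fst p - zs))\<^sup>2 + 2 / \<mu> * breg (snd p)"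

lemma breg_nonneg: "0 \<le> breg z"
  using f_convex by (simp add: breg_def)

lemma lyap_ge: "(norm (fst p - zs))\<^sup>2 \<le> lyap p"
  using breg_nonneg \<mu>_pos by (simp add: lyap_def)

lemma lyap_nonneg: "0 \<le> lyap p"
  using lyap_ge[of p] by (meson order_trans zero_le_power2)

text \<open>The middle point is built with the same weights as the new aggregate, so the two differ
  by \<open>\<alpha> *\<^sub>R (zh - z)\<close>: smoothness from \<open>md\<close> costs only order
  \<open>\<alpha>\<^sup>2\<close>. Convexity at \<open>md\<close>, tested at \<open>ag\<close> and
  at \<open>zs\<close>, gives the contraction.\<close>

lemma breg_step:
  fixes ag z :: 'a
  assumes "0 \<le> \<alpha>" "\<alpha> \<le> 1"
  defines "md \<equiv> (1 - \<alpha>) *\<^sub>R ag + \<alpha> *\<^sub>R z"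
  shows "breg ((1 - \<alpha>) *\<^sub>R ag + \<alpha> *\<^sub>R zh)
    \<le> (1 - \<alpha>) * breg ag + \<alpha> * ((g md - g zs) \<bullet> (zh - zs)) + L * \<alpha>\<^sup>2 / 2 * (norm (zh - z))\<^sup>2"
proof -
  let ?agn = "(1 - \<alpha>) *\<^sub>R ag + \<alpha> *\<^sub>R zh" and ?D = "g md - g zs"
  have "?agn - md = \<alpha> *\<^sub>R (zh - z)" by (simp add: md_def algebra_simps)
  then have "(norm (?agn - md))\<^sup>2 = \<alpha>\<^sup>2 * (norm (zh - z))\<^sup>2" by (simp add: power_mult_distrib)
  moreover have "?D \<bullet> (?agn - md) = g md \<bullet> (?agn - md) - g zs \<bullet> (?agn - zs) + g zs \<bullet> (md - zs)"
    by (simp add: inner_diff_left inner_diff_right)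
  ultimately have up: "breg ?agn \<le> breg md + ?D \<bullet> (?agn - md) + L * \<alpha>\<^sup>2 / 2 * (norm (zh - z))\<^sup>2"
    using f_smooth[of ?agn md] unfolding breg_def by simp
  have ag: "breg md + ?D \<bullet> (ag - md) \<le> breg ag"
    using f_convex[of ag md] unfolding breg_def by (simp add: inner_diff_left inner_diff_right)
  have zs: "breg md + ?D \<bullet> (zs - md) \<le> 0"
    using f_convex[of zs md] unfolding breg_def by (simp add: inner_diff_left inner_diff_right)
  \<comment> \<open>Splits \<open>?agn - md\<close> into \<open>1 - \<alpha>\<close> times
    \<open>ag - md\<close>, \<open>\<alpha>\<close> times \<open>zs - md\<close> and
    \<open>\<alpha>\<close> times \<open>zh - zs\<close>, with \<open>breg md\<close> distributed by
    the same weights.\<close>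
  have "breg md + ?D \<bullet> (?agn - md)
      = (1 - \<alpha>) * (breg md + ?D \<bullet> (ag - md)) + \<alpha> * (breg md + ?D \<bullet> (zs - md))
        + \<alpha> * (?D \<bullet> (zh - zs))"
    by (simp add: inner_add_right inner_diff_right algebra_simps)
  also have "\<dots> \<le> (1 - \<alpha>) * breg ag + \<alpha> * 0 + \<alpha> * (?D \<bullet> (zh - zs))"
    using assms ag zs by (intro add_mono mult_left_mono) auto
  finally show ?thesis using up by simp
qed

text \<open>
  \<open>e\<close> is the noise of the gradient sample, which both half steps use; \<open>e1\<close> and \<open>e2\<close> are the noises of
  the two coupling samples.
\<close>
lemma lyap_step:
  fixes \<alpha> r \<beta> :: real and z ag e e1 :: 'a
  assumes \<alpha>: "0 < \<alpha>" "\<alpha> \<le> 1" and r: "0 < r" "r < 1" and \<beta>: "0 < \<beta>"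
    and step: "\<alpha>\<^sup>2 * (L / \<mu> + (1 + \<beta>) * K\<^sup>2 / \<mu>\<^sup>2) + 2 * \<alpha> \<le> r"
  defines "\<eta> \<equiv> \<alpha> / \<mu>" and "md \<equiv> (1 - \<alpha>) *\<^sub>R ag + \<alpha> *\<^sub>R z"
  defines "zh \<equiv> z - \<eta> *\<^sub>R (g md + W z + e + e1)"
  shows "lyap (z - \<eta> *\<^sub>R (g md + W zh + e + e2), (1 - \<alpha>) *\<^sub>R ag + \<alpha> *\<^sub>R zh)
    \<le> (1 - \<alpha>) * lyap (z, ag) + \<eta>\<^sup>2 / (1 - r) * (norm e)\<^sup>2 - 2 * \<eta> * (e \<bullet> (z - zs))
      + \<eta>\<^sup>2 * (1 + 1 / \<beta>) * (norm e1)\<^sup>2 + \<eta>\<^sup>2 * (norm e2)\<^sup>2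
      + 2 * \<eta> * (e2 \<bullet> (\<eta> *\<^sub>R (W zh - W z - e1) - (zh - zs)))"
proof -
  let ?g1 = "g md + W z + e + e1" and ?g2 = "g md + W zh + e + e2"
  let ?q = "zh - z" and ?w = "W zh - W z"
  let ?D = "g md - g zs"
  have \<eta>: "0 < \<eta>" "\<alpha> = \<eta> * \<mu>" using \<alpha> \<mu>_pos by (auto simp: \<eta>_def)
  have ex: "(norm (z - \<eta> *\<^sub>R ?g2 - zs))\<^sup>2 = (norm (z - zs))\<^sup>2 - 2 * \<eta> * (?g2 \<bullet> (zh - zs))
    + \<eta>\<^sup>2 * (norm (?g2 - ?g1))\<^sup>2 - (norm ?q)\<^sup>2"
    unfolding zh_def by (rule extragradient_identity)
  \<comment> \<open>Subtracting the vanishing \<open>g zs + W zs\<close> produces differences: one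
    for the monotonicity of \<open>W\<close>, the other matching the gradient term of
    \<open>breg_step\<close>.\<close>
  have "?g2 = ?D + (W zh - W zs) + e + e2"
  proof -
    have "?g2 = ?D + (W zh - W zs) + e + e2 + (g zs + W zs)" by simp
    then show ?thesis by (simp add: zs_root)
  qed
  then have "?g2 \<bullet> (zh - zs) = ?D \<bullet> (zh - zs) + (W zh - W zs) \<bullet> (zh - zs) + (e + e2) \<bullet> (zh - zs)"
    by (simp only: inner_add_left)
  then have "?D \<bullet> (zh - zs) + \<mu> * (norm (zh - zs))\<^sup>2 + (e + e2) \<bullet> (zh - zs) \<le> ?g2 \<bullet> (zh - zs)"
    using W_monotone[of zh zs] by simp
  from mult_left_mono[OF this, of "2 * \<eta>"]
  have mono: "2 * \<eta> * (?D \<bullet> (zh - zs)) + 2 * \<alpha> * (norm (zh - zs))\<^sup>2 + 2 * \<eta> * ((e + e2) \<bullet> (zh - zs))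
      \<le> 2 * \<eta> * (?g2 \<bullet> (zh - zs))"
    using \<eta> by (simp only: distrib_left mult.assoc)
  \<comment> \<open>Strong monotonicity gains a square at \<open>zh\<close>, while the contraction
    needs it at \<open>z\<close>. The exchange costs
    \<open>2 * \<alpha> * (norm ?q)\<^sup>2\<close>, the linear term of the stepsize
    condition.\<close>
  have "(norm (z - zs))\<^sup>2 \<le> (norm (zh - zs - ?q))\<^sup>2" by simp
  also have "\<dots> \<le> 2 * (norm (zh - zs))\<^sup>2 + 2 * (norm ?q)\<^sup>2"
    using power2_norm_diff_le[of 1 "zh - zs" ?q] by simp
  finally have "(norm (z - zs))\<^sup>2 \<le> 2 * (norm (zh - zs))\<^sup>2 + 2 * (norm ?q)\<^sup>2" .
  from mult_left_mono[OF this, of \<alpha>]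
  have half: "\<alpha> * (norm (z - zs))\<^sup>2 \<le> 2 * \<alpha> * (norm (zh - zs))\<^sup>2 + 2 * \<alpha> * (norm ?q)\<^sup>2"
    using \<alpha> by (simp add: distrib_left mult_ac)
  have "2 / \<mu> * breg ((1 - \<alpha>) *\<^sub>R ag + \<alpha> *\<^sub>R zh) \<le> 2 / \<mu> * ((1 - \<alpha>) * breg ag + \<alpha> * (?D \<bullet> (zh - zs))
      + L * \<alpha>\<^sup>2 / 2 * (norm ?q)\<^sup>2)"
    using breg_step[of \<alpha> ag zh z] \<alpha> \<mu>_pos unfolding md_def[symmetric]
    by (intro mult_left_mono) auto
  also have "\<dots> = (1 - \<alpha>) * (2 / \<mu> * breg ag) + 2 * \<eta> * (?D \<bullet> (zh - zs)) + \<alpha>\<^sup>2 * (L / \<mu>) * (norm ?q)\<^sup>2"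
    using \<mu>_pos by (simp add: \<eta>_def field_simps)
  finally have V: "2 / \<mu> * breg ((1 - \<alpha>) *\<^sub>R ag + \<alpha> *\<^sub>R zh) \<le>
    (1 - \<alpha>) * (2 / \<mu> * breg ag) + 2 * \<eta> * (?D \<bullet> (zh - zs)) + \<alpha>\<^sup>2 * (L / \<mu>) * (norm ?q)\<^sup>2" .
  \<comment> \<open>The shared noise \<open>e\<close> cancels in the difference. \<open>e2\<close>
    is expanded exactly instead of by Young's inequality: its cross term is kept because it will
    average out, so its square has coefficient 1.\<close>
  have g21: "?g2 - ?g1 = ?w - e1 + e2" by simp
  have sq_add: "(norm (a + e2))\<^sup>2 = (norm a)\<^sup>2 + 2 * (e2 \<bullet> a) + (norm e2)\<^sup>2" for a
    by (simp add: power2_norm_eq_inner inner_add_left inner_add_right inner_commute)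
  have "(norm (?g2 - ?g1))\<^sup>2 = (norm (?w - e1))\<^sup>2 + 2 * (e2 \<bullet> (?w - e1)) + (norm e2)\<^sup>2"
    by (simp only: g21 sq_add)
  also have "(norm (?w - e1))\<^sup>2 \<le> (1 + \<beta>) * (norm ?w)\<^sup>2 + (1 + 1 / \<beta>) * (norm e1)\<^sup>2"
    using \<beta> by (rule power2_norm_diff_le)
  also have "(norm ?w)\<^sup>2 \<le> K\<^sup>2 * (norm ?q)\<^sup>2"
    using power_mono[OF W_lipschitz norm_ge_zero, of zh z 2] by (simp add: power_mult_distrib)
  finally have "(norm (?g2 - ?g1))\<^sup>2 \<le> (1 + \<beta>) * (K\<^sup>2 * (norm ?q)\<^sup>2) + (1 + 1 / \<beta>) * (norm e1)\<^sup>2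
      + 2 * (e2 \<bullet> (?w - e1)) + (norm e2)\<^sup>2" using \<beta> by simp
  then have "\<eta>\<^sup>2 * (norm (?g2 - ?g1))\<^sup>2 \<le> \<eta>\<^sup>2 * ((1 + \<beta>) * (K\<^sup>2 * (norm ?q)\<^sup>2) + (1 + 1 / \<beta>) * (norm e1)\<^sup>2
      + 2 * (e2 \<bullet> (?w - e1)) + (norm e2)\<^sup>2)" by (intro mult_left_mono) auto
  also have "\<dots> = \<alpha>\<^sup>2 * ((1 + \<beta>) * K\<^sup>2 / \<mu>\<^sup>2) * (norm ?q)\<^sup>2 + \<eta>\<^sup>2 * (1 + 1 / \<beta>) * (norm e1)\<^sup>2
      + 2 * \<eta> * (e2 \<bullet> (\<eta> *\<^sub>R (?w - e1))) + \<eta>\<^sup>2 * (norm e2)\<^sup>2"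
    by (simp add: \<eta>_def algebra_simps power2_eq_square add_divide_distrib)
  finally have G: "\<eta>\<^sup>2 * (norm (?g2 - ?g1))\<^sup>2 \<le> \<alpha>\<^sup>2 * ((1 + \<beta>) * K\<^sup>2 / \<mu>\<^sup>2) * (norm ?q)\<^sup>2
      + \<eta>\<^sup>2 * (1 + 1 / \<beta>) * (norm e1)\<^sup>2
      + 2 * \<eta> * (e2 \<bullet> (\<eta> *\<^sub>R (?w - e1))) + \<eta>\<^sup>2 * (norm e2)\<^sup>2" .
  \<comment> \<open>\<open>e\<close> also enters \<open>zh\<close>, so
    \<open>e \<bullet> (zh - zs)\<close> need not average out. Only its part along \<open>?q\<close>
    is estimated, with the share \<open>1 - r\<close> of the negative square; the part along
    \<open>z - zs\<close> is kept for the expectation.\<close>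
  have Y: "- 2 * \<eta> * (e \<bullet> ?q) \<le> (1 - r) * (norm ?q)\<^sup>2 + \<eta>\<^sup>2 / (1 - r) * (norm e)\<^sup>2"
    using inner_young[of "1 - r" "\<eta> *\<^sub>R e" ?q] r \<eta> by (simp add: power_mult_distrib)
  have "(\<alpha>\<^sup>2 * (L / \<mu> + (1 + \<beta>) * K\<^sup>2 / \<mu>\<^sup>2) + 2 * \<alpha>) * (norm ?q)\<^sup>2 \<le> r * (norm ?q)\<^sup>2"
    using step by (rule mult_right_mono) simp
  then have "\<alpha>\<^sup>2 * (L / \<mu>) * (norm ?q)\<^sup>2 + \<alpha>\<^sup>2 * ((1 + \<beta>) * K\<^sup>2 / \<mu>\<^sup>2) * (norm ?q)\<^sup>2
      + 2 * \<alpha> * (norm ?q)\<^sup>2 \<le> r * (norm ?q)\<^sup>2"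
    by (simp add: algebra_simps)
  moreover have "2 * \<eta> * ((e + e2) \<bullet> (zh - zs)) = 2 * \<eta> * (e \<bullet> ?q) + 2 * \<eta> * (e \<bullet> (z - zs))
      + 2 * \<eta> * (e2 \<bullet> (zh - zs))"
    by (simp add: inner_add_left inner_diff_right algebra_simps)
  moreover have "2 * \<eta> * (e2 \<bullet> (\<eta> *\<^sub>R (?w - e1) - (zh - zs)))
     = 2 * \<eta> * (e2 \<bullet> (\<eta> *\<^sub>R (?w - e1))) - 2 * \<eta> * (e2 \<bullet> (zh - zs))"
    by (simp only: inner_diff_right right_diff_distrib)
  moreover have "(1 - \<alpha>) * lyap (z, ag) = (norm (z - zs))\<^sup>2 - \<alpha> * (norm (z - zs))\<^sup>2 + (1 - \<alpha>) * (2 / \<mu> * breg ag)"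
    "(1 - r) * (norm ?q)\<^sup>2 = (norm ?q)\<^sup>2 - r * (norm ?q)\<^sup>2"
    by (simp_all add: lyap_def algebra_simps)
  moreover have "lyap (z - \<eta> *\<^sub>R ?g2, (1 - \<alpha>) *\<^sub>R ag + \<alpha> *\<^sub>R zh)
     = (norm (z - \<eta> *\<^sub>R ?g2 - zs))\<^sup>2 + 2 / \<mu> * breg ((1 - \<alpha>) *\<^sub>R ag + \<alpha> *\<^sub>R zh)"
    by (simp add: lyap_def)
  ultimately show ?thesis using ex mono half V G Y by linarith
qed

end

section \<open>Fresh samples\<close>

abbreviation generated_measure :: "'w measure \<Rightarrow> ('i \<Rightarrow> 'w set set) \<Rightarrow> 'i set \<Rightarrow> 'w measure" where
  "generated_measure M E J \<equiv> sigma (space M) (\<Union>i\<in>J. E i)"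

lemma measurable_generated_mono:
  assumes "X \<in> measurable (generated_measure M E J) N" "J \<subseteq> J'" "\<And>i. i \<in> J' \<Longrightarrow> E i \<subseteq> Pow (space M)"
  shows "X \<in> measurable (generated_measure M E J') N"
  using assms measurable_mono1[of "\<Union>i\<in>J'. E i" "space M" "\<Union>i\<in>J. E i"] by blast

lemma measurable_generated_sample:
  assumes "Y \<in> measurable M D" "j \<in> J" "E j = {Y -` A \<inter> space M |A. A \<in> sets D}"
    and "\<And>i. i \<in> J \<Longrightarrow> E i \<subseteq> Pow (space M)"
  shows "Y \<in> measurable (generated_measure M E J) D"
proof (rule measurableI)
  have E: "(\<Union>i\<in>J. E i) \<subseteq> Pow (space M)" using assms(4) by blast
  fix A assume "A \<in> sets D"
  with assms have "Y -` A \<inter> space M \<in> (\<Union>i\<in>J. E i)" by blast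
  then show "Y -` A \<inter> space (generated_measure M E J) \<in> sets (generated_measure M E J)"
    using E by (simp add: space_measure_of_conv sigma_sets.Basic)
qed (use assms(1) in \<open>auto simp: space_measure_of_conv dest: measurable_space\<close>)

context prob_space
begin

text \<open>Disjoint blocks of independent intersection-stable families generate independent
  sigma-algebras. Hence a variable determined by the samples in \<open>J\<close> and a sample
  outside \<open>J\<close> have a product law, which is checked on rectangles.\<close>

lemma distr_pair_fresh:
  assumes indep: "indep_sets E I" and J: "J \<subseteq> I" and j: "j \<in> I" "j \<notin> J"
    and stable: "\<And>i. i \<in> I \<Longrightarrow> Int_stable (E i)"
    and X: "X \<in> measurable (generated_measure M E J) N" and Y: "Y \<in> measurable M D"
    and Ej: "E j = {Y -` A \<inter> space M |A. A \<in> sets D}"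
  shows "distr M N X \<Otimes>\<^sub>M distr M D Y = distr M (N \<Otimes>\<^sub>M D) (\<lambda>\<omega>. (X \<omega>, Y \<omega>))"
    and "X \<in> measurable M N"
proof -
  have E: "E i \<subseteq> events" if "i \<in> I" for i
    using indep that by (auto simp: indep_sets_def)
  then have EJ: "(\<Union>i\<in>J. E i) \<subseteq> events" using J by blast
  then have Pow: "(\<Union>i\<in>J. E i) \<subseteq> Pow (space M)" using sets.space_closed by (rule subset_trans)
  \<comment> \<open>A family of two blocks indexed by \<open>bool\<close>: the past \<open>J\<close>
    and the single fresh index \<open>j\<close>.\<close>
  let ?K = "case_bool J {j}"
  have "(\<Union>b. ?K b) \<subseteq> I" using J j by (auto split: bool.splits)
  then have "indep_sets E (\<Union>b. ?K b)" using indep by (rule indep_sets_mono_index)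
  then have *: "indep_sets (\<lambda>b. sigma_sets (space M) (\<Union>i\<in>?K b. E i)) UNIV"
    by (rule indep_sets_collect_sigma)
      (use stable J j in \<open>auto simp: disjoint_family_on_def split: bool.splits\<close>)
  have "indep_set (sigma_sets (space M) (\<Union>i\<in>J. E i)) (sigma_sets (space M) (E j))"
    unfolding indep_set_def by (rule indep_sets_mono_sets[OF *]) (auto split: bool.splits)
  note indep' = indep_setD[OF this]
  have gen: "sets (generated_measure M E J) = sigma_sets (space M) (\<Union>i\<in>J. E i)"
    using Pow by simp
  have "sets (generated_measure M E J) \<subseteq> events"
    unfolding gen using EJ by (rule sets.sigma_sets_subset)
  then show XM: "X \<in> measurable M N"
    using X by (auto simp: measurable_def space_measure_of_conv)
  interpret X: prob_space "distr M N X" using XM by (rule prob_space_distr)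
  interpret Y: prob_space "distr M D Y" using Y by (rule prob_space_distr)
  show "distr M N X \<Otimes>\<^sub>M distr M D Y = distr M (N \<Otimes>\<^sub>M D) (\<lambda>\<omega>. (X \<omega>, Y \<omega>))"
  proof (rule pair_measure_eqI)
    fix A B assume "A \<in> sets (distr M N X)" "B \<in> sets (distr M D Y)"
    then have A: "A \<in> sets N" and B: "B \<in> sets D" by auto
    have "X -` A \<inter> space M \<in> sigma_sets (space M) (\<Union>i\<in>J. E i)"
      using measurable_sets[OF X A] gen by (simp add: space_measure_of_conv)
    moreover have "Y -` B \<inter> space M \<in> sigma_sets (space M) (E j)"
      using Ej B by (intro sigma_sets.Basic) auto
    ultimately have "prob ((X -` A \<inter> space M) \<inter> (Y -` B \<inter> space M))
        = prob (X -` A \<inter> space M) * prob (Y -` B \<inter> space M)"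
      by (rule indep')
    moreover have "(\<lambda>\<omega>. (X \<omega>, Y \<omega>)) -` (A \<times> B) \<inter> space M = (X -` A \<inter> space M) \<inter> (Y -` B \<inter> space M)"
      by auto
    ultimately show "emeasure (distr M N X) A * emeasure (distr M D Y) B
        = emeasure (distr M (N \<Otimes>\<^sub>M D) (\<lambda>\<omega>. (X \<omega>, Y \<omega>))) (A \<times> B)"
      using A B XM Y by (simp add: emeasure_distr emeasure_eq_measure ennreal_mult)
  qed (auto intro: X.sigma_finite_measure_axioms Y.sigma_finite_measure_axioms)
qed

text \<open>Plays the role of conditioning on the past: the product law and Tonelli's theorem allow
  the fresh sample to be integrated with \<open>X\<close> frozen. Nonnegative integrals require no
  prior integrability.\<close>

lemma nn_integral_fresh:
  assumes indep: "indep_sets E I" and J: "J \<subseteq> I" and j: "j \<in> I" "j \<notin> J"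
    and stable: "\<And>i. i \<in> I \<Longrightarrow> Int_stable (E i)"
    and X: "X \<in> measurable (generated_measure M E J) N" and Y: "Y \<in> measurable M D"
    and Ej: "E j = {Y -` A \<inter> space M |A. A \<in> sets D}"
    and D: "distr M D Y = D" and \<phi>: "\<phi> \<in> borel_measurable (N \<Otimes>\<^sub>M D)"
  shows "(\<integral>\<^sup>+\<omega>. \<phi> (X \<omega>, Y \<omega>) \<partial>M) = (\<integral>\<^sup>+\<omega>. \<integral>\<^sup>+y. \<phi> (X \<omega>, y) \<partial>D \<partial>M)"
proof -
  note pair = distr_pair_fresh[OF indep J j stable X Y Ej]
  note [measurable] = pair(2) Y \<phi>
  interpret D: prob_space D using Y prob_space_distr D by metis
  have "(\<integral>\<^sup>+\<omega>. \<phi> (X \<omega>, Y \<omega>) \<partial>M) = (\<integral>\<^sup>+p. \<phi> p \<partial>distr M (N \<Otimes>\<^sub>M D) (\<lambda>\<omega>. (X \<omega>, Y \<omega>)))"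
    by (simp add: nn_integral_distr)
  also have "\<dots> = (\<integral>\<^sup>+p. \<phi> p \<partial>(distr M N X \<Otimes>\<^sub>M D))"
    using pair(1) by (simp add: D)
  also have "\<dots> = (\<integral>\<^sup>+x. \<integral>\<^sup>+y. \<phi> (x, y) \<partial>D \<partial>distr M N X)"
    by (rule D.nn_integral_fst[symmetric]) measurable
  also have "\<dots> = (\<integral>\<^sup>+\<omega>. \<integral>\<^sup>+y. \<phi> (X \<omega>, y) \<partial>D \<partial>M)"
    by (rule nn_integral_distr) measurable
  finally show ?thesis .
qed

end

definition sample_events ::
    "'w measure \<Rightarrow> 's measure \<Rightarrow> 'z measure \<Rightarrow> (nat \<Rightarrow> 'w \<Rightarrow> 's) \<Rightarrow> (nat \<Rightarrow> 'w \<Rightarrow> 'z) \<Rightarrow>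
     (nat \<Rightarrow> 'w \<Rightarrow> 'z) \<Rightarrow> sample_index \<Rightarrow> 'w set set" where
  "sample_events M DS DZ \<xi> \<zeta>h \<zeta> i = (case i of
     Xi_half t \<Rightarrow> {\<xi> t -` A \<inter> space M |A. A \<in> sets DS}
   | Zeta_half t \<Rightarrow> {\<zeta>h t -` A \<inter> space M |A. A \<in> sets DZ}
   | Zeta_full t \<Rightarrow> {\<zeta> t -` A \<inter> space M |A. A \<in> sets DZ})"

definition sample_indices :: "nat \<Rightarrow> sample_index set" where
  "sample_indices t = Xi_half ` {1..t} \<union> Zeta_half ` {1..t} \<union> Zeta_full ` {1..t}"

lemma Int_stable_preimages: "Int_stable {X -` A \<inter> \<Omega> |A. A \<in> sets N}"
proof (rule Int_stableI)
  fix a b assume "a \<in> {X -` A \<inter> \<Omega> |A. A \<in> sets N}" "b \<in> {X -` A \<inter> \<Omega> |A. A \<in> sets N}"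
  then obtain A B where "a = X -` A \<inter> \<Omega>" "b = X -` B \<inter> \<Omega>" "A \<in> sets N" "B \<in> sets N" by blast
  then have "a \<inter> b = X -` (A \<inter> B) \<inter> \<Omega>" "A \<inter> B \<in> sets N" by auto
  then show "a \<inter> b \<in> {X -` A \<inter> \<Omega> |A. A \<in> sets N}" by blast
qed

lemma Int_stable_sample_events: "Int_stable (sample_events M DS DZ \<xi> \<zeta>h \<zeta> i)"
  by (cases i) (simp_all add: sample_events_def Int_stable_preimages)

lemma sample_events_Pow: "sample_events M DS DZ \<xi> \<zeta>h \<zeta> i \<subseteq> Pow (space M)"
  by (cases i) (auto simp: sample_events_def)

section \<open>The Lyapunov function in expectation\<close>

text \<open>Integrates out one sample of a nested integral. The signed noise terms live in the real
  function \<open>U\<close>, where they can average to zero, while the result is again a bound in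
  \<open>ennreal\<close>.\<close>

lemma nn_integral_le_ennreal:
  assumes "\<And>x. h x \<le> ennreal (U x)" "\<And>x. 0 \<le> U x" "integrable D U" "(\<integral>x. U x \<partial>D) \<le> c"
  shows "(\<integral>\<^sup>+x. h x \<partial>D) \<le> ennreal c"
proof -
  have "(\<integral>\<^sup>+x. h x \<partial>D) \<le> (\<integral>\<^sup>+x. ennreal (U x) \<partial>D)" using assms by (intro nn_integral_mono) auto
  also have "\<dots> = ennreal (\<integral>x. U x \<partial>D)" using assms by (intro nn_integral_eq_integral) auto
  also have "\<dots> \<le> ennreal c" using assms by (intro ennreal_leI)
  finally show ?thesis .
qed

text \<open>Each noise enters the descent bound through a constant, a square and a linear term;
  unbiasedness removes the last.\<close>

lemma (in prob_space) integral_quadratic_noise: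
  fixes X :: "'a \<Rightarrow> 'b::euclidean_space"
  assumes X: "has_bochner_integral M X m"
    and sq: "integrable M (\<lambda>\<omega>. (norm (X \<omega> - m))\<^sup>2)" "(\<integral>\<omega>. (norm (X \<omega> - m))\<^sup>2 \<partial>M) \<le> s"
    and a: "0 \<le> a"
  shows "integrable M (\<lambda>\<omega>. C + a * (norm (X \<omega> - m))\<^sup>2 + b * ((X \<omega> - m) \<bullet> v))"
    and "(\<integral>\<omega>. C + a * (norm (X \<omega> - m))\<^sup>2 + b * ((X \<omega> - m) \<bullet> v) \<partial>M) \<le> C + a * s"
proof -
  have int: "integrable M X" "(\<integral>\<omega>. X \<omega> \<partial>M) = m"
    using X by (auto simp: has_bochner_integral_iff)
  then have lin: "integrable M (\<lambda>\<omega>. (X \<omega> - m) \<bullet> v)" "(\<integral>\<omega>. (X \<omega> - m) \<bullet> v \<partial>M) = 0"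
    by (auto simp: inner_diff_left prob_space)
  show "integrable M (\<lambda>\<omega>. C + a * (norm (X \<omega> - m))\<^sup>2 + b * ((X \<omega> - m) \<bullet> v))"
    using lin sq by auto
  have "(\<integral>\<omega>. C + a * (norm (X \<omega> - m))\<^sup>2 + b * ((X \<omega> - m) \<bullet> v) \<partial>M)
      = C + a * (\<integral>\<omega>. (norm (X \<omega> - m))\<^sup>2 \<partial>M)"
    using lin sq by (simp add: prob_space)
  also have "\<dots> \<le> C + a * s" using sq a by (simp add: mult_left_mono)
  finally show "(\<integral>\<omega>. C + a * (norm (X \<omega> - m))\<^sup>2 + b * ((X \<omega> - m) \<bullet> v) \<partial>M) \<le> C + a * s" .
qed

section \<open>Expected descent with unbiased oracles\<close>

locale stochastic_ageg = composite_operator f g W L K \<mu> zs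
  for f :: "'a::euclidean_space \<Rightarrow> real" and g W L K \<mu> zs +
  fixes DS :: "'s measure" and DZ :: "'z measure"
    and go :: "'a \<Rightarrow> 's \<Rightarrow> 'a" and ho :: "'a \<Rightarrow> 'z \<Rightarrow> 'a" and vS vB :: real
  assumes prob_DS: "prob_space DS" and prob_DZ: "prob_space DZ"
    and go_measurable: "(\<lambda>(z, s). go z s) \<in> borel_measurable (borel \<Otimes>\<^sub>M DS)"
    and ho_measurable: "(\<lambda>(z, s). ho z s) \<in> borel_measurable (borel \<Otimes>\<^sub>M DZ)"
    and f_measurable [measurable]: "f \<in> borel_measurable borel"
    and go_unbiased: "has_bochner_integral DS (go z) (g z)"
    and ho_unbiased: "has_bochner_integral DZ (ho z) (W z)"
    and go_variance: "integrable DS (\<lambda>s. (norm (go z s - g z))\<^sup>2)"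
      "(\<integral>s. (norm (go z s - g z))\<^sup>2 \<partial>DS) \<le> vS"
    and ho_variance: "integrable DZ (\<lambda>s. (norm (ho z s - W z))\<^sup>2)"
      "(\<integral>s. (norm (ho z s - W z))\<^sup>2 \<partial>DZ) \<le> vB"
begin

text \<open>The state is the pair of current point and aggregated point; the middle point is recomputed from it.\<close>
definition step :: "real \<Rightarrow> 'a \<times> 'a \<Rightarrow> 's \<Rightarrow> 'z \<Rightarrow> 'z \<Rightarrow> 'a \<times> 'a" where
  "step \<alpha> p s \<zeta>h \<zeta> =
     (let md = (1 - \<alpha>) *\<^sub>R snd p + \<alpha> *\<^sub>R fst p;
          zh = fst p - (\<alpha> / \<mu>) *\<^sub>R (go md s + ho (fst p) \<zeta>h)
      in (fst p - (\<alpha> / \<mu>) *\<^sub>R (go md s + ho zh \<zeta>), (1 - \<alpha>) *\<^sub>R snd p + \<alpha> *\<^sub>R zh))"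

lemma go_compose [measurable (raw)]:
  assumes [measurable]: "a \<in> borel_measurable N" "b \<in> measurable N DS"
  shows "(\<lambda>x. go (a x) (b x)) \<in> borel_measurable N"
  using measurable_compose[OF _ go_measurable, of "\<lambda>x. (a x, b x)" N] by simp

lemma ho_compose [measurable (raw)]:
  assumes [measurable]: "a \<in> borel_measurable N" "b \<in> measurable N DZ"
  shows "(\<lambda>x. ho (a x) (b x)) \<in> borel_measurable N"
  using measurable_compose[OF _ ho_measurable, of "\<lambda>x. (a x, b x)" N] by simp

lemma step_compose [measurable (raw)]:
  assumes [measurable]: "p \<in> measurable N (borel \<Otimes>\<^sub>M borel)" "a \<in> measurable N DS"
    "b \<in> measurable N DZ" "c \<in> measurable N DZ"
  shows "(\<lambda>x. step \<alpha> (p x) (a x) (b x) (c x)) \<in> measurable N (borel \<Otimes>\<^sub>M borel)"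
  unfolding step_def Let_def by measurable

lemma lyap_measurable [measurable]: "lyap \<in> borel_measurable (borel \<Otimes>\<^sub>M borel)"
  unfolding lyap_def[abs_def] breg_def by measurable

text \<open>Integration runs against the order of drawing. With \<open>s\<close> and
  \<open>\<zeta>h\<close> fixed, the half step is fixed too, so the linear term in the last noise
  averages out; then the square of the first coupling noise is averaged, and finally the gradient
  noise.\<close>

lemma nn_integral_lyap_step:
  fixes \<alpha> r \<beta> :: real
  assumes \<alpha>: "0 < \<alpha>" "\<alpha> \<le> 1" and r: "0 < r" "r < 1" and \<beta>: "0 < \<beta>"
    and step: "\<alpha>\<^sup>2 * (L / \<mu> + (1 + \<beta>) * K\<^sup>2 / \<mu>\<^sup>2) + 2 * \<alpha> \<le> r"
  shows "(\<integral>\<^sup>+s. \<integral>\<^sup>+\<zeta>h. \<integral>\<^sup>+\<zeta>. ennreal (lyap (step \<alpha> p s \<zeta>h \<zeta>)) \<partial>DZ \<partial>DZ \<partial>DS)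
    \<le> ennreal ((1 - \<alpha>) * lyap p + (\<alpha> / \<mu>)\<^sup>2 * (vS / (1 - r) + (2 + 1 / \<beta>) * vB))"
proof -
  interpret DS: prob_space DS by (rule prob_DS)
  interpret DZ: prob_space DZ by (rule prob_DZ)
  obtain z ag where p: "p = (z, ag)" by (cases p)
  define \<eta> where "\<eta> = \<alpha> / \<mu>"
  define md where "md = (1 - \<alpha>) *\<^sub>R ag + \<alpha> *\<^sub>R z"
  define e where "e s = go md s - g md" for s
  define e1 where "e1 \<zeta>h = ho z \<zeta>h - W z" for \<zeta>h
  define zh where "zh s \<zeta>h = z - \<eta> *\<^sub>R (g md + W z + e s + e1 \<zeta>h)" for s \<zeta>h
  define v where "v s \<zeta>h = \<eta> *\<^sub>R (W (zh s \<zeta>h) - W z - e1 \<zeta>h) - (zh s \<zeta>h - zs)" for s \<zeta>h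
  \<comment> \<open>\<open>U3\<close>, \<open>U2\<close>, \<open>U1\<close> bound the integrand with
    the last two, the last one and none of the samples integrated out. The constant in
    \<open>U3\<close> reserves the variance of both coupling samples,
    \<open>2 + 1 / \<beta> = (1 + 1 / \<beta>) + 1\<close>; \<open>U2\<close> and \<open>U1\<close>
    trade these shares for the actual squares.\<close>
  define U3 where "U3 s = (1 - \<alpha>) * lyap p + \<eta>\<^sup>2 * (2 + 1 / \<beta>) * vB
    + \<eta>\<^sup>2 / (1 - r) * (norm (e s))\<^sup>2 + (- 2 * \<eta>) * (e s \<bullet> (z - zs))" for s
  \<comment> \<open>The zero linear term only brings the expression into the shape of
    \<open>integral_quadratic_noise\<close>.\<close>
  define U2 where "U2 s \<zeta>h = (U3 s - \<eta>\<^sup>2 * (1 + 1 / \<beta>) * vB)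
    + \<eta>\<^sup>2 * (1 + 1 / \<beta>) * (norm (e1 \<zeta>h))\<^sup>2 + 0 * (e1 \<zeta>h \<bullet> 0)" for s \<zeta>h
  define U1 where "U1 s \<zeta>h \<zeta> = (U2 s \<zeta>h - \<eta>\<^sup>2 * vB) + \<eta>\<^sup>2 * (norm (ho (zh s \<zeta>h) \<zeta> - W (zh s \<zeta>h)))\<^sup>2
    + 2 * \<eta> * ((ho (zh s \<zeta>h) \<zeta> - W (zh s \<zeta>h)) \<bullet> v s \<zeta>h)" for s \<zeta>h \<zeta>
  have lyap_U1: "lyap (step \<alpha> p s \<zeta>h \<zeta>) \<le> U1 s \<zeta>h \<zeta>" for s \<zeta>h \<zeta>
  proof -
    have "step \<alpha> p s \<zeta>h \<zeta> = (z - \<eta> *\<^sub>R (g md + W (zh s \<zeta>h) + e s + (ho (zh s \<zeta>h) \<zeta> - W (zh s \<zeta>h))),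
        (1 - \<alpha>) *\<^sub>R ag + \<alpha> *\<^sub>R zh s \<zeta>h)"
      by (simp add: step_def Let_def p zh_def e_def e1_def \<eta>_def md_def algebra_simps)
    then show ?thesis
      using lyap_step[OF assms, where z = z and ag = ag and e = "e s" and ?e1.0 = "e1 \<zeta>h"
          and ?e2.0 = "ho (zh s \<zeta>h) \<zeta> - W (zh s \<zeta>h)"]
      unfolding U1_def U2_def U3_def v_def \<eta>_def[symmetric] md_def[symmetric]
        zh_def[symmetric] p by (simp add: algebra_simps)
  qed
  have \<eta>2: "0 \<le> \<eta>\<^sup>2" "0 \<le> \<eta>\<^sup>2 * (1 + 1 / \<beta>)" "0 \<le> \<eta>\<^sup>2 / (1 - r)" using r \<beta> by auto
  \<comment> \<open>Nonnegativity, needed to pass to \<open>ennreal\<close>, is not visible in the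
    formulas: \<open>U1\<close> dominates \<open>lyap\<close>, and \<open>U2\<close> and
    \<open>U3\<close> dominate integrals of nonnegative functions.\<close>
  have U1_nonneg: "0 \<le> U1 s \<zeta>h \<zeta>" for s \<zeta>h \<zeta>
    using lyap_nonneg lyap_U1 order_trans by blast
  have int1: "integrable DZ (U1 s \<zeta>h)" "(\<integral>\<zeta>. U1 s \<zeta>h \<zeta> \<partial>DZ) \<le> U2 s \<zeta>h" for s \<zeta>h
    using DZ.integral_quadratic_noise[OF ho_unbiased ho_variance \<eta>2(1),
        of "U2 s \<zeta>h - \<eta>\<^sup>2 * vB" "zh s \<zeta>h" "2 * \<eta>" "v s \<zeta>h"]
    unfolding U1_def[abs_def] by simp_all
  have U2_nonneg: "0 \<le> U2 s \<zeta>h" for s \<zeta>h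
    by (rule order_trans[OF Bochner_Integration.integral_nonneg int1(2)]) (rule U1_nonneg)
  have int2: "integrable DZ (U2 s)" "(\<integral>\<zeta>h. U2 s \<zeta>h \<partial>DZ) \<le> U3 s" for s
    using DZ.integral_quadratic_noise[OF ho_unbiased ho_variance \<eta>2(2),
        of "U3 s - \<eta>\<^sup>2 * (1 + 1 / \<beta>) * vB" z 0 0]
    unfolding U2_def[abs_def] e1_def by simp_all
  have U3_nonneg: "0 \<le> U3 s" for s
    by (rule order_trans[OF Bochner_Integration.integral_nonneg int2(2)]) (rule U2_nonneg)
  have int3: "integrable DS U3"
    "(\<integral>s. U3 s \<partial>DS) \<le> (1 - \<alpha>) * lyap p + \<eta>\<^sup>2 * (2 + 1 / \<beta>) * vB + \<eta>\<^sup>2 / (1 - r) * vS"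
    using DS.integral_quadratic_noise[OF go_unbiased go_variance \<eta>2(3),
        of "(1 - \<alpha>) * lyap p + \<eta>\<^sup>2 * (2 + 1 / \<beta>) * vB" md "- 2 * \<eta>" "z - zs"]
    unfolding U3_def[abs_def] e_def by simp_all
  have "(\<integral>\<^sup>+s. \<integral>\<^sup>+\<zeta>h. \<integral>\<^sup>+\<zeta>. ennreal (lyap (step \<alpha> p s \<zeta>h \<zeta>)) \<partial>DZ \<partial>DZ \<partial>DS)
      \<le> ennreal ((1 - \<alpha>) * lyap p + \<eta>\<^sup>2 * (2 + 1 / \<beta>) * vB + \<eta>\<^sup>2 / (1 - r) * vS)"
    by (intro nn_integral_le_ennreal[OF _ U3_nonneg int3] nn_integral_le_ennreal[OF _ U2_nonneg int2]
        nn_integral_le_ennreal[OF _ U1_nonneg int1] ennreal_leI lyap_U1)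
  then show ?thesis by (simp add: \<eta>_def algebra_simps)
qed

text \<open>The three samples of an iteration are added to the past one at a time, in the order of
  drawing. Each lies outside the index set generating everything before it, so
  \<open>nn_integral_fresh\<close> applies three times, beginning with the sample drawn
  last.\<close>

lemma nn_integral_process_step:
  fixes M :: "'w measure" and T k :: nat and Z :: "'w \<Rightarrow> 'a \<times> 'a" and \<alpha> r \<beta> :: real
  assumes M: "prob_space M" and samples: "independent_samples M DS DZ T \<xi> \<zeta>h \<zeta>" and k: "k < T"
  defines "\<F> \<equiv> \<lambda>t. generated_measure M (sample_events M DS DZ \<xi> \<zeta>h \<zeta>) (sample_indices t)"
  defines "Z' \<equiv> \<lambda>\<omega>. step \<alpha> (Z \<omega>) (\<xi> (Suc k) \<omega>) (\<zeta>h (Suc k) \<omega>) (\<zeta> (Suc k) \<omega>)"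
  assumes Z: "Z \<in> measurable (\<F> k) (borel \<Otimes>\<^sub>M borel)"
  shows "Z' \<in> measurable (\<F> (Suc k)) (borel \<Otimes>\<^sub>M borel)"
    and "(\<integral>\<^sup>+\<omega>. ennreal (lyap (Z' \<omega>)) \<partial>M) =
      (\<integral>\<^sup>+\<omega>. \<integral>\<^sup>+s. \<integral>\<^sup>+z1. \<integral>\<^sup>+z2. ennreal (lyap (step \<alpha> (Z \<omega>) s z1 z2)) \<partial>DZ \<partial>DZ \<partial>DS \<partial>M)"
    and "Z \<in> measurable M (borel \<Otimes>\<^sub>M borel)"
proof -
  interpret M: prob_space M by (rule M)
  interpret DS: prob_space DS by (rule prob_DS)
  interpret DZ: prob_space DZ by (rule prob_DZ)
  let ?E = "sample_events M DS DZ \<xi> \<zeta>h \<zeta>" and ?t = "Suc k"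
  let ?G = "generated_measure M ?E"
  let ?J0 = "sample_indices k" and ?I = "sample_indices T"
  let ?J1 = "insert (Xi_half ?t) ?J0"
  let ?J2 = "insert (Zeta_half ?t) ?J1"
  have t: "?t \<in> {1..T}" using k by auto
  have indep: "M.indep_sets ?E ?I"
    using samples unfolding independent_samples_def sample_events_def[abs_def] sample_indices_def
    by blast
  have laws: "\<xi> ?t \<in> measurable M DS" "\<zeta>h ?t \<in> measurable M DZ" "\<zeta> ?t \<in> measurable M DZ"
    "distr M DS (\<xi> ?t) = DS" "distr M DZ (\<zeta>h ?t) = DZ" "distr M DZ (\<zeta> ?t) = DZ"
    using samples t unfolding independent_samples_def by blast+
  have Ej: "?E (Xi_half ?t) = {\<xi> ?t -` A \<inter> space M |A. A \<in> sets DS}"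
    "?E (Zeta_half ?t) = {\<zeta>h ?t -` A \<inter> space M |A. A \<in> sets DZ}"
    "?E (Zeta_full ?t) = {\<zeta> ?t -` A \<inter> space M |A. A \<in> sets DZ}"
    by (simp_all add: sample_events_def)
  have J: "?J0 \<subseteq> ?I" "?J1 \<subseteq> ?I" "?J2 \<subseteq> ?I" "Xi_half ?t \<in> ?I" "Zeta_half ?t \<in> ?I" "Zeta_full ?t \<in> ?I"
    "Xi_half ?t \<notin> ?J0" "Zeta_half ?t \<notin> ?J1" "Zeta_full ?t \<notin> ?J2"
    "insert (Zeta_full ?t) ?J2 = sample_indices ?t"
    using k by (auto simp: sample_indices_def atLeastAtMostSuc_conv)
  note mono = measurable_generated_mono[where E = ?E, OF _ _ sample_events_Pow]
  note sample = measurable_generated_sample[where E = ?E, OF _ _ _ sample_events_Pow]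
  note fresh = M.nn_integral_fresh[OF indep _ _ _ Int_stable_sample_events]
  have X0: "Z \<in> measurable (?G ?J0) (borel \<Otimes>\<^sub>M borel)" using Z by (simp add: \<F>_def)
  then show "Z \<in> measurable M (borel \<Otimes>\<^sub>M borel)"
    by (rule M.distr_pair_fresh(2)[OF indep J(1,4,7) Int_stable_sample_events _ laws(1) Ej(1)])
  have X1: "(\<lambda>\<omega>. (Z \<omega>, \<xi> ?t \<omega>)) \<in> measurable (?G ?J1) ((borel \<Otimes>\<^sub>M borel) \<Otimes>\<^sub>M DS)"
    by (intro measurable_Pair mono[OF X0] sample[OF laws(1) _ Ej(1)]) auto
  have X2: "(\<lambda>\<omega>. ((Z \<omega>, \<xi> ?t \<omega>), \<zeta>h ?t \<omega>)) \<in> measurable (?G ?J2) (((borel \<Otimes>\<^sub>M borel) \<Otimes>\<^sub>M DS) \<Otimes>\<^sub>M DZ)"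
    by (intro measurable_Pair[OF mono[OF X1]] sample[OF laws(2) _ Ej(2)]) auto
  have X3: "(\<lambda>\<omega>. (((Z \<omega>, \<xi> ?t \<omega>), \<zeta>h ?t \<omega>), \<zeta> ?t \<omega>))
      \<in> measurable (\<F> ?t) ((((borel \<Otimes>\<^sub>M borel) \<Otimes>\<^sub>M DS) \<Otimes>\<^sub>M DZ) \<Otimes>\<^sub>M DZ)"
    unfolding \<F>_def J(10)[symmetric]
    by (intro measurable_Pair[OF mono[OF X2]] sample[OF laws(3) _ Ej(3)]) auto
  have S: "(\<lambda>q. step \<alpha> (fst (fst (fst q))) (snd (fst (fst q))) (snd (fst q)) (snd q))
      \<in> measurable ((((borel \<Otimes>\<^sub>M borel) \<Otimes>\<^sub>M DS) \<Otimes>\<^sub>M DZ) \<Otimes>\<^sub>M DZ) (borel \<Otimes>\<^sub>M borel)"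
    by measurable
  from measurable_compose[OF X3 S] show "Z' \<in> measurable (\<F> ?t) (borel \<Otimes>\<^sub>M borel)"
    by (simp add: Z'_def)
  let ?\<phi> = "\<lambda>q. ennreal (lyap (step \<alpha> (fst (fst (fst q))) (snd (fst (fst q))) (snd (fst q)) (snd q)))"
  have "(\<integral>\<^sup>+\<omega>. ennreal (lyap (Z' \<omega>)) \<partial>M)
      = (\<integral>\<^sup>+\<omega>. ?\<phi> (((Z \<omega>, \<xi> ?t \<omega>), \<zeta>h ?t \<omega>), \<zeta> ?t \<omega>) \<partial>M)"
    by (simp add: Z'_def)
  also have "\<dots> = (\<integral>\<^sup>+\<omega>. \<integral>\<^sup>+z2. ?\<phi> (((Z \<omega>, \<xi> ?t \<omega>), \<zeta>h ?t \<omega>), z2) \<partial>DZ \<partial>M)"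
    by (rule fresh[OF J(3,6,9) X2 laws(3) Ej(3) laws(6)]) measurable
  also have "\<dots> = (\<integral>\<^sup>+\<omega>. \<integral>\<^sup>+z1. \<integral>\<^sup>+z2. ?\<phi> (((Z \<omega>, \<xi> ?t \<omega>), z1), z2) \<partial>DZ \<partial>DZ \<partial>M)"
    by (rule fresh[OF J(2,5,8) X1 laws(2) Ej(2) laws(5),
          where \<phi> = "\<lambda>q. \<integral>\<^sup>+z2. ?\<phi> (q, z2) \<partial>DZ"]) measurable
  also have "\<dots> = (\<integral>\<^sup>+\<omega>. \<integral>\<^sup>+s. \<integral>\<^sup>+z1. \<integral>\<^sup>+z2. ?\<phi> (((Z \<omega>, s), z1), z2) \<partial>DZ \<partial>DZ \<partial>DS \<partial>M)"
    by (rule fresh[OF J(1,4,7) X0 laws(1) Ej(1) laws(4),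
          where \<phi> = "\<lambda>q. \<integral>\<^sup>+z1. \<integral>\<^sup>+z2. ?\<phi> ((q, z1), z2) \<partial>DZ \<partial>DZ"]) measurable
  finally show "(\<integral>\<^sup>+\<omega>. ennreal (lyap (Z' \<omega>)) \<partial>M) =
      (\<integral>\<^sup>+\<omega>. \<integral>\<^sup>+s. \<integral>\<^sup>+z1. \<integral>\<^sup>+z2. ennreal (lyap (step \<alpha> (Z \<omega>) s z1 z2)) \<partial>DZ \<partial>DZ \<partial>DS \<partial>M)"
    by simp
qed

text \<open>The induction runs on nonnegative integrals, so integrability of the iterates is a
  result and not a prerequisite. Adaptedness, proved first, provides the independence of each new
  sample from the current state.\<close>

lemma expected_lyap_bound:
  fixes M :: "'w measure" and T t :: nat and Z :: "nat \<Rightarrow> 'w \<Rightarrow> 'a \<times> 'a" and \<alpha> :: "nat \<Rightarrow> real"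
    and r \<beta> :: real
  assumes M: "prob_space M" and samples: "independent_samples M DS DZ T \<xi> \<zeta>h \<zeta>"
    and Z_0: "\<And>\<omega>. Z 0 \<omega> = p0"
    and Z_Suc: "\<And>k \<omega>. k < T \<Longrightarrow>
      Z (Suc k) \<omega> = step (\<alpha> (Suc k)) (Z k \<omega>) (\<xi> (Suc k) \<omega>) (\<zeta>h (Suc k) \<omega>) (\<zeta> (Suc k) \<omega>)"
    and r: "0 < r" "r < 1" and \<beta>: "0 < \<beta>"
    and \<alpha>: "\<And>k. k \<in> {1..T} \<Longrightarrow> 0 < \<alpha> k \<and> \<alpha> k \<le> 1 \<and>
      (\<alpha> k)\<^sup>2 * (L / \<mu> + (1 + \<beta>) * K\<^sup>2 / \<mu>\<^sup>2) + 2 * \<alpha> k \<le> r"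
    and t: "t \<le> T"
  defines "c \<equiv> vS / (1 - r) + (2 + 1 / \<beta>) * vB"
  shows "Z t \<in> measurable M (borel \<Otimes>\<^sub>M borel)" and "integrable M (\<lambda>\<omega>. lyap (Z t \<omega>))"
    and "(\<integral>\<omega>. lyap (Z t \<omega>) \<partial>M) \<le> lyap p0 * (\<Prod>\<tau>=1..t. 1 - \<alpha> \<tau>)
      + c / \<mu>\<^sup>2 * (\<Sum>\<tau>=1..t. (\<alpha> \<tau>)\<^sup>2 * (\<Prod>\<tau>'=\<tau>+1..t. 1 - \<alpha> \<tau>'))"
proof -
  interpret M: prob_space M by (rule M)
  let ?G = "\<lambda>t. generated_measure M (sample_events M DS DZ \<xi> \<zeta>h \<zeta>) (sample_indices t)"
  have "0 \<le> vS"
    by (rule order_trans[OF Bochner_Integration.integral_nonneg go_variance(2)]) simp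
  moreover have "0 \<le> vB"
    by (rule order_trans[OF Bochner_Integration.integral_nonneg ho_variance(2)]) simp
  ultimately have c: "0 \<le> c" using r \<beta> by (auto simp: c_def)
  have adapted: "Z k \<in> measurable (?G k) (borel \<Otimes>\<^sub>M borel)" if "k \<le> T" for k
    using that
  proof (induction k)
    case 0
    have "Z 0 = (\<lambda>\<omega>. p0)" using Z_0 by auto
    then show ?case by (auto simp: space_pair_measure intro: measurable_const)
  next
    case (Suc k)
    then have "k < T" by simp
    moreover have "Z (Suc k) = (\<lambda>\<omega>. step (\<alpha> (Suc k)) (Z k \<omega>) (\<xi> (Suc k) \<omega>) (\<zeta>h (Suc k) \<omega>) (\<zeta> (Suc k) \<omega>))"
      using Z_Suc[OF \<open>k < T\<close>] by auto
    ultimately show ?case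
      using nn_integral_process_step(1)[OF M samples \<open>k < T\<close> Suc.IH] by simp
  qed
  \<comment> \<open>A real majorant satisfying the recursion with equality; its nonnegativity is
    carried along so that \<open>ennreal\<close> respects the sums and products.\<close>
  define b where "b = rec_nat (lyap p0) (\<lambda>k x. (1 - \<alpha> (Suc k)) * x + c / \<mu>\<^sup>2 * (\<alpha> (Suc k))\<^sup>2)"
  have b_Suc: "b (Suc k) = (1 - \<alpha> (Suc k)) * b k + c / \<mu>\<^sup>2 * (\<alpha> (Suc k))\<^sup>2" for k
    by (simp add: b_def)
  have main: "Z k \<in> measurable M (borel \<Otimes>\<^sub>M borel) \<and> 0 \<le> b k \<and> (\<integral>\<^sup>+\<omega>. ennreal (lyap (Z k \<omega>)) \<partial>M) \<le> ennreal (b k)"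
    if "k \<le> T" for k
    using that
  proof (induction k)
    case 0
    have "Z 0 = (\<lambda>\<omega>. p0)" using Z_0 by auto
    then show ?case by (auto simp: b_def lyap_nonneg M.emeasure_space_1 space_pair_measure
        intro: measurable_const)
  next
    case (Suc k)
    let ?a = "\<alpha> (Suc k)"
    have k: "k < T" using Suc.prems by simp
    have \<alpha>k: "0 < ?a" "?a \<le> 1" "?a\<^sup>2 * (L / \<mu> + (1 + \<beta>) * K\<^sup>2 / \<mu>\<^sup>2) + 2 * ?a \<le> r"
      using \<alpha>[of "Suc k"] Suc.prems by auto
    note Z_step = nn_integral_process_step[OF M samples k adapted[OF less_imp_le[OF k]]]
    have [measurable]: "Z k \<in> measurable M (borel \<Otimes>\<^sub>M borel)" by (rule Z_step(3))
    have IH: "0 \<le> b k" "(\<integral>\<^sup>+\<omega>. ennreal (lyap (Z k \<omega>)) \<partial>M) \<le> ennreal (b k)"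
      using Suc by auto
    have samp: "\<xi> (Suc k) \<in> measurable M DS" "\<zeta>h (Suc k) \<in> measurable M DZ" "\<zeta> (Suc k) \<in> measurable M DZ"
      using samples Suc.prems unfolding independent_samples_def by auto
    have "Z (Suc k) \<in> measurable M (borel \<Otimes>\<^sub>M borel)"
      unfolding Z_Suc[OF k, abs_def] using samp by measurable
    have "(\<integral>\<^sup>+\<omega>. ennreal (lyap (Z (Suc k) \<omega>)) \<partial>M)
        \<le> (\<integral>\<^sup>+\<omega>. ennreal ((1 - ?a) * lyap (Z k \<omega>) + (?a / \<mu>)\<^sup>2 * c) \<partial>M)"
      unfolding Z_Suc[OF k] Z_step(2) c_def
      by (intro nn_integral_mono nn_integral_lyap_step \<alpha>k r \<beta>)
    also have "\<dots> = (\<integral>\<^sup>+\<omega>. ennreal (1 - ?a) * ennreal (lyap (Z k \<omega>)) + ennreal ((?a / \<mu>)\<^sup>2 * c) \<partial>M)"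
      using \<alpha>k c by (simp add: ennreal_plus ennreal_mult lyap_nonneg)
    also have "\<dots> = ennreal (1 - ?a) * (\<integral>\<^sup>+\<omega>. ennreal (lyap (Z k \<omega>)) \<partial>M) + ennreal ((?a / \<mu>)\<^sup>2 * c)"
      by (simp add: nn_integral_add nn_integral_cmult M.emeasure_space_1)
    also have "\<dots> \<le> ennreal (1 - ?a) * ennreal (b k) + ennreal ((?a / \<mu>)\<^sup>2 * c)"
      using IH by (intro add_right_mono mult_left_mono) auto
    also have "\<dots> = ennreal (b (Suc k))"
      using \<alpha>k c IH by (simp add: b_Suc ennreal_plus ennreal_mult power_divide mult_ac)
    finally have "(\<integral>\<^sup>+\<omega>. ennreal (lyap (Z (Suc k) \<omega>)) \<partial>M) \<le> ennreal (b (Suc k))" .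
    moreover have "0 \<le> b (Suc k)" using \<alpha>k c IH by (simp add: b_Suc)
    ultimately show ?case using \<open>Z (Suc k) \<in> _\<close> by blast
  qed
  note Zt = main[OF t]
  then show Zm [measurable]: "Z t \<in> measurable M (borel \<Otimes>\<^sub>M borel)" by blast
  \<comment> \<open>Finiteness of the nonnegative integral gives integrability, which then
    identifies it with the real integral.\<close>
  show int: "integrable M (\<lambda>\<omega>. lyap (Z t \<omega>))"
  proof (rule integrableI_nonneg)
    show "(\<integral>\<^sup>+\<omega>. ennreal (lyap (Z t \<omega>)) \<partial>M) < \<infinity>"
      using Zt by (auto intro: le_less_trans)
  qed (auto simp: lyap_nonneg)
  have "ennreal (\<integral>\<omega>. lyap (Z t \<omega>) \<partial>M) \<le> ennreal (b t)"
    using Zt nn_integral_eq_integral[OF int] by (simp add: lyap_nonneg)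
  then have "(\<integral>\<omega>. lyap (Z t \<omega>) \<partial>M) \<le> b t" using Zt by (simp add: ennreal_le_iff)
  also have "b t \<le> b 0 * (\<Prod>\<tau>=1..t. 1 - \<alpha> \<tau>)
      + c / \<mu>\<^sup>2 * (\<Sum>\<tau>=1..t. (\<alpha> \<tau>)\<^sup>2 * (\<Prod>\<tau>'=\<tau>+1..t. 1 - \<alpha> \<tau>'))"
    using \<alpha> t by (intro prod_recursion_bound) (auto simp: b_Suc)
  finally show "(\<integral>\<omega>. lyap (Z t \<omega>) \<partial>M) \<le> lyap p0 * (\<Prod>\<tau>=1..t. 1 - \<alpha> \<tau>)
      + c / \<mu>\<^sup>2 * (\<Sum>\<tau>=1..t. (\<alpha> \<tau>)\<^sup>2 * (\<Prod>\<tau>'=\<tau>+1..t. 1 - \<alpha> \<tau>'))"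
    by (simp add: b_def)
qed

end

section \<open>Rescaling the saddle point problem\<close>

text \<open>\<open>grad\<close> is a definite description, so uniqueness of the derivative is
  required; testing two candidates on their difference gives it.\<close>

lemma grad_eqI: "GDERIV f x :> D \<Longrightarrow> grad f x = D"
proof -
  assume D: "GDERIV f x :> D"
  have "D' = D" if "GDERIV f x :> D'" for D'
  proof -
    have "(\<lambda>h. h \<bullet> D') = (\<lambda>h. h \<bullet> D)"
      using that D unfolding gderiv_def by (rule has_derivative_unique)
    then have "(D' - D) \<bullet> D' = (D' - D) \<bullet> D" by meson
    then have "(D' - D) \<bullet> (D' - D) = 0" by (simp only: inner_diff_right)
    then show ?thesis by simp
  qed
  with D show ?thesis unfolding grad_def by (intro the_equality)
qed

lemma inner_transpose_mult_vec:
  fixes B :: "real^'m^'n"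
  shows "x \<bullet> (B *v y) = (transpose B *v x) \<bullet> y"
  by (simp add: dot_lmul_matrix)

lemma grad_bilinear_coupling:
  "grad (\<lambda>x'. bilinear_coupling B ux uy x' y) x = B *v y - ux"
  "grad (\<lambda>y'. bilinear_coupling B ux uy x y') y = transpose B *v x + uy"
proof -
  show "grad (\<lambda>x'. bilinear_coupling B ux uy x' y) x = B *v y - ux"
    unfolding bilinear_coupling_def
    by (rule grad_eqI) (auto simp: gderiv_def inner_diff_right intro!: derivative_eq_intros)
  show "grad (\<lambda>y'. bilinear_coupling B ux uy x y') y = transpose B *v x + uy"
    unfolding bilinear_coupling_def inner_transpose_mult_vec
    by (rule grad_eqI) (auto simp: gderiv_def inner_add_right inner_commute intro!: derivative_eq_intros)
qed

text \<open>Compare both bounds for two points at distance 1. This makes \<open>LStr\<close>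
  nonnegative.\<close>

lemma smooth_strongly_convex_le:
  fixes F :: "'a::euclidean_space \<Rightarrow> real"
  assumes "smooth_strongly_convex L \<mu> F"
  shows "\<mu> \<le> L"
proof -
  obtain b :: 'a where "b \<in> Basis" using nonempty_Basis by blast
  then have "norm (b - 0) = 1" by simp
  moreover have "\<mu> / 2 * (norm (b - 0))\<^sup>2 \<le> L / 2 * (norm (b - 0))\<^sup>2"
    using assms unfolding smooth_strongly_convex_def by (meson order_trans)
  ultimately show ?thesis by simp
qed

text \<open>In each variable the coupling is affine, so the saddle inequality together with the
  smoothness upper bound makes a linear plus quadratic form nonnegative in every direction.\<close>

lemma saddle_point_stationary:
  assumes F: "smooth_strongly_convex LF \<mu>F F" and G: "smooth_strongly_convex LG \<mu>G G"
    and saddle: "saddle_point (\<lambda>x y. F x + bilinear_coupling B ux uy x y - G y) wx wy"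
  shows "grad F wx + (B *v wy - ux) = 0" and "grad G wy - (transpose B *v wx + uy) = 0"
proof -
  show "grad F wx + (B *v wy - ux) = 0"
  proof (rule zero_if_quadratic_nonneg)
    fix d
    have "F (wx + d) - F wx - grad F wx \<bullet> d \<le> LF / 2 * (norm d)\<^sup>2"
      using F unfolding smooth_strongly_convex_def by (metis add_diff_cancel_left')
    moreover have "F wx + bilinear_coupling B ux uy wx wy \<le> F (wx + d) + bilinear_coupling B ux uy (wx + d) wy"
      using saddle unfolding saddle_point_def by (metis diff_le_eq diff_add_cancel)
    ultimately show "0 \<le> (grad F wx + (B *v wy - ux)) \<bullet> d + LF / 2 * (norm d)\<^sup>2"
      by (simp add: bilinear_coupling_def inner_add_left inner_add_right inner_diff_left
          inner_diff_right inner_commute)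
  qed
  show "grad G wy - (transpose B *v wx + uy) = 0"
  proof (rule zero_if_quadratic_nonneg)
    fix d
    have "G (wy + d) - G wy - grad G wy \<bullet> d \<le> LG / 2 * (norm d)\<^sup>2"
      using G unfolding smooth_strongly_convex_def by (metis add_diff_cancel_left')
    moreover have "bilinear_coupling B ux uy wx (wy + d) - G (wy + d) \<le> bilinear_coupling B ux uy wx wy - G wy"
      using saddle unfolding saddle_point_def by (smt (verit))
    ultimately show "0 \<le> (grad G wy - (transpose B *v wx + uy)) \<bullet> d + LG / 2 * (norm d)\<^sup>2"
      unfolding bilinear_coupling_def inner_transpose_mult_vec
      by (simp only: inner_add_left inner_add_right inner_diff_left)
  qed
qed

text \<open>Scaling the second block by \<open>s = sqrt R\<close> divides the constants of
  \<open>G\<close> by \<open>R\<close>: its modulus becomes \<open>\<mu>G / R = \<mu>F\<close> and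
  its smoothness \<open>\<mu>F / \<mu>G * LG\<close>. The maps are prescribed at points
  \<open>(x, s *\<^sub>R y)\<close>, which reach everything because \<open>s\<close> is
  positive.\<close>

lemma composite_operator_rescaled:
  fixes F :: "real^'n \<Rightarrow> real" and G :: "real^'m \<Rightarrow> real" and B :: "real^'m^'n"
    and f :: "(real^'n) \<times> (real^'m) \<Rightarrow> real" and g W :: "(real^'n) \<times> (real^'m) \<Rightarrow> (real^'n) \<times> (real^'m)"
  assumes \<mu>: "0 < \<mu>F" "0 < \<mu>G" and R: "R = \<mu>G / \<mu>F" and s: "s = sqrt R"
    and F: "smooth_strongly_convex LF \<mu>F F" and G: "smooth_strongly_convex LG \<mu>G G"
    and saddle: "saddle_point (\<lambda>x y. F x + bilinear_coupling B ux uy x y - G y) wx wy"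
    and f: "\<And>x y. f (x, s *\<^sub>R y) = F x + G y - \<mu>F / 2 * ((norm x)\<^sup>2 + R * (norm y)\<^sup>2)"
    and g: "\<And>x y. g (x, s *\<^sub>R y) = (grad F x - \<mu>F *\<^sub>R x, (1 / s) *\<^sub>R grad G y - \<mu>F *\<^sub>R s *\<^sub>R y)"
    and W: "\<And>x y. W (x, s *\<^sub>R y) = (\<mu>F *\<^sub>R x + (B *v y - ux),
      \<mu>F *\<^sub>R s *\<^sub>R y - (1 / s) *\<^sub>R (transpose B *v x + uy))"
  shows "composite_operator f g W (max LF (\<mu>F / \<mu>G * LG) - \<mu>F)
    (sqrt (lambda_max (transpose B ** B) * (\<mu>F / \<mu>G) + \<mu>F\<^sup>2)) \<mu>F (wx, s *\<^sub>R wy)"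
proof -
  let ?l = "lambda_max (transpose B ** B)" and ?L = "max LF (\<mu>F / \<mu>G * LG)"
  have R_pos: "0 < R" using \<mu> by (simp add: R)
  then have s_pos: "0 < s" and s2: "s * s = R" by (simp_all add: s)
  have coords: "\<exists>x y. z = (x, s *\<^sub>R y)" for z :: "(real^'n) \<times> (real^'m)"
    using s_pos by (intro exI[of _ "fst z"] exI[of _ "(1 / s) *\<^sub>R snd z"]) simp
  have norm_diff: "(norm ((x, s *\<^sub>R y) - (x', s *\<^sub>R y')))\<^sup>2 = (norm (x - x'))\<^sup>2 + R * (norm (y - y'))\<^sup>2"
    for x x' :: "real^'n" and y y' :: "real^'m"
    unfolding power2_norm_eq_inner
    by (simp add: inner_prod_def scaleR_diff_right[symmetric] s2[symmetric])
  have three_point: "(norm a)\<^sup>2 - (norm b)\<^sup>2 - 2 * (b \<bullet> (a - b)) = (norm (a - b))\<^sup>2" for a b :: "'v::real_inner"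
    by (simp add: power2_norm_eq_inner inner_diff_left inner_diff_right inner_commute)
  \<comment> \<open>The Bregman remainder of the squared norm is exactly the squared distance
    (\<open>three_point\<close>), so subtracting the quadratic lowers both curvature bounds by
    \<open>\<mu>F\<close>.\<close>
  have breg: "f (x, s *\<^sub>R y) - f (x', s *\<^sub>R y') - g (x', s *\<^sub>R y') \<bullet> ((x, s *\<^sub>R y) - (x', s *\<^sub>R y'))
      = (F x - F x' - grad F x' \<bullet> (x - x')) + (G y - G y' - grad G y' \<bullet> (y - y'))
        - \<mu>F / 2 * ((norm (x - x'))\<^sup>2 + R * (norm (y - y'))\<^sup>2)" for x x' y y'
  proof -
    have "g (x', s *\<^sub>R y') \<bullet> ((x, s *\<^sub>R y) - (x', s *\<^sub>R y'))
        = grad F x' \<bullet> (x - x') + grad G y' \<bullet> (y - y')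
          - \<mu>F * (x' \<bullet> (x - x')) - \<mu>F * (R * (y' \<bullet> (y - y')))"
      using s_pos
      by (simp add: g inner_prod_def inner_diff_left scaleR_diff_right[symmetric] s2[symmetric]
          right_diff_distrib)
    then show ?thesis
      unfolding f three_point[symmetric] by (simp add: algebra_simps)
  qed
  have F': "\<mu>F / 2 * (norm (x - x'))\<^sup>2 \<le> F x - F x' - grad F x' \<bullet> (x - x')"
    "F x - F x' - grad F x' \<bullet> (x - x') \<le> LF / 2 * (norm (x - x'))\<^sup>2" for x x'
    using F unfolding smooth_strongly_convex_def by blast+
  have G': "\<mu>G / 2 * (norm (x - x'))\<^sup>2 \<le> G x - G x' - grad G x' \<bullet> (x - x')"
    "G x - G x' - grad G x' \<bullet> (x - x') \<le> LG / 2 * (norm (x - x'))\<^sup>2" for x x'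
    using G unfolding smooth_strongly_convex_def by blast+
  have \<mu>R: "\<mu>G = \<mu>F * R" using \<mu> by (simp add: R)
  have LF: "LF \<le> ?L" by simp
  have "\<mu>F / \<mu>G * LG \<le> ?L" by simp
  then have "\<mu>F / \<mu>G * LG * R \<le> ?L * R" using R_pos by (intro mult_right_mono) auto
  moreover have "\<mu>F / \<mu>G * LG * R = LG" using \<mu> by (simp add: R)
  ultimately have LG: "LG \<le> ?L * R" by simp
  have Wdiff: "W (x, s *\<^sub>R y) - W (x', s *\<^sub>R y')
      = (\<mu>F *\<^sub>R (x - x') + B *v (y - y'), \<mu>F *\<^sub>R s *\<^sub>R (y - y') - (1 / s) *\<^sub>R (transpose B *v (x - x')))"
    for x x' y y'
    by (simp add: W matrix_vector_mult_diff_distrib scaleR_diff_right scaleR_add_right del: transpose_matrix_vector)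
  have diff: "(x, s *\<^sub>R y) - (x', s *\<^sub>R y') = (x - x', s *\<^sub>R (y - y'))"
    for x x' :: "real^'n" and y y' :: "real^'m"
    by (simp add: scaleR_diff_right)
  \<comment> \<open>\<open>a \<bullet> (B *v b)\<close> occurs twice with opposite signs and
    cancels, here and in \<open>skew_norm\<close>. This is why monotonicity has modulus exactly
    \<open>\<mu>F\<close> and why the square of the Lipschitz constant has no mixed term.\<close>
  have skew: "(\<mu>F *\<^sub>R a + B *v b, \<mu>F *\<^sub>R s *\<^sub>R b - (1 / s) *\<^sub>R (transpose B *v a)) \<bullet> (a, s *\<^sub>R b)
      = \<mu>F * ((norm a)\<^sup>2 + R * (norm b)\<^sup>2)" for a b
    using s_pos inner_transpose_mult_vec[of a B b]
    by (simp add: inner_prod_def inner_add_left inner_diff_left power2_norm_eq_inner s2[symmetric]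
        inner_commute algebra_simps del: transpose_matrix_vector)
  have skew_norm: "(norm (\<mu>F *\<^sub>R a + B *v b, \<mu>F *\<^sub>R s *\<^sub>R b - (1 / s) *\<^sub>R (transpose B *v a)))\<^sup>2
      = \<mu>F\<^sup>2 * ((norm a)\<^sup>2 + R * (norm b)\<^sup>2) + (norm (B *v b))\<^sup>2 + (norm (transpose B *v a))\<^sup>2 / R" for a b
    using s_pos inner_transpose_mult_vec[of a B b] unfolding power2_norm_eq_inner
    by (simp add: inner_prod_def inner_add_left inner_add_right inner_diff_left inner_diff_right
        s2[symmetric] inner_commute algebra_simps power2_eq_square
        del: transpose_matrix_vector)
  show ?thesis
  proof
    fix z z' :: "(real^'n) \<times> (real^'m)"
    obtain x y x' y' where z: "z = (x, s *\<^sub>R y)" "z' = (x', s *\<^sub>R y')" using coords[of z] coords[of z'] by blast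
    let ?dx = "x - x'" and ?dy = "y - y'"
    show "0 \<le> f z - f z' - g z' \<bullet> (z - z')"
      unfolding z breg using F'(1)[of x x'] G'(1)[of y y'] by (simp add: \<mu>R algebra_simps)
    have "LF / 2 * (norm ?dx)\<^sup>2 \<le> ?L / 2 * (norm ?dx)\<^sup>2"
      using LF by (intro mult_right_mono) auto
    moreover have "LG / 2 * (norm ?dy)\<^sup>2 \<le> ?L * R / 2 * (norm ?dy)\<^sup>2"
      using LG by (intro mult_right_mono) auto
    moreover have "(?L - \<mu>F) / 2 * ((norm ?dx)\<^sup>2 + R * (norm ?dy)\<^sup>2)
      = ?L / 2 * (norm ?dx)\<^sup>2 + ?L * R / 2 * (norm ?dy)\<^sup>2 - \<mu>F / 2 * ((norm ?dx)\<^sup>2 + R * (norm ?dy)\<^sup>2)"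
      by (simp add: field_simps)
    ultimately show "f z - f z' - g z' \<bullet> (z - z') \<le> (?L - \<mu>F) / 2 * (norm (z - z'))\<^sup>2"
      unfolding z breg norm_diff using F'(2)[of x x'] G'(2)[of y y'] by linarith
    have "(W z - W z') \<bullet> (z - z') = \<mu>F * (norm (z - z'))\<^sup>2"
      unfolding z norm_diff Wdiff unfolding diff skew ..
    then show "\<mu>F * (norm (z - z'))\<^sup>2 \<le> (W z - W z') \<bullet> (z - z')" by simp
    have "(norm (W z - W z'))\<^sup>2 = \<mu>F\<^sup>2 * ((norm ?dx)\<^sup>2 + R * (norm ?dy)\<^sup>2)
        + (norm (B *v ?dy))\<^sup>2 + (norm (transpose B *v ?dx))\<^sup>2 / R"
      unfolding z Wdiff skew_norm ..
    also have "\<dots> \<le> \<mu>F\<^sup>2 * ((norm ?dx)\<^sup>2 + R * (norm ?dy)\<^sup>2) + ?l * (norm ?dy)\<^sup>2 + ?l * (norm ?dx)\<^sup>2 / R"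
      using R_pos norm_mult_vec_le_lambda_max[of B ?dy] norm_transpose_mult_vec_le_lambda_max[of B ?dx]
      by (intro add_mono divide_right_mono) auto
    also have "\<dots> = (?l * (\<mu>F / \<mu>G) + \<mu>F\<^sup>2) * (norm (z - z'))\<^sup>2"
      unfolding z norm_diff using \<mu> by (simp add: R field_simps)
    finally have "norm (W z - W z') \<le> sqrt ((?l * (\<mu>F / \<mu>G) + \<mu>F\<^sup>2) * (norm (z - z'))\<^sup>2)"
      by (rule real_le_rsqrt)
    then show "norm (W z - W z') \<le> sqrt (?l * (\<mu>F / \<mu>G) + \<mu>F\<^sup>2) * norm (z - z')"
      by (simp add: real_sqrt_mult)
  next
    show "g (wx, s *\<^sub>R wy) + W (wx, s *\<^sub>R wy) = 0"
      using saddle_point_stationary[OF F G saddle]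
      by (simp add: g W scaleR_diff_right[symmetric] zero_prod_def del: transpose_matrix_vector)
  qed (rule \<mu>)
qed

section \<open>Identification of the algorithm with the abstract process\<close>

text \<open>The middle point stored after \<open>k\<close> iterations already uses the next weight
  \<open>\<alpha> (Suc k)\<close>; for \<open>k = 0\<close> all three points coincide, so any weight
  gives the same combination. Hence the abstract state can omit it.\<close>

lemma ageg_md:
  fixes nf ng hx hy \<mu>F \<mu>G R \<eta> \<alpha> \<xi> \<zeta>h \<zeta> x0 y0
  defines "S \<equiv> ageg nf ng hx hy \<mu>F \<mu>G R \<eta> \<alpha> \<xi> \<zeta>h \<zeta> x0 y0"
  shows "st_xmd (S k) = (1 - \<alpha> (Suc k)) *\<^sub>R st_xag (S k) + \<alpha> (Suc k) *\<^sub>R st_x (S k)"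
    and "st_ymd (S k) = (1 - \<alpha> (Suc k)) *\<^sub>R st_yag (S k) + \<alpha> (Suc k) *\<^sub>R st_y (S k)"
  unfolding S_def
  by (cases k; simp add: ageg_step_def Let_def scaleR_add_left[symmetric])+

theorem theorem5p1:
  fixes F :: "real^'n \<Rightarrow> real" and G :: "real^'m \<Rightarrow> real"
    and B :: "real^'m^'n" and ux :: "real^'n" and uy :: "real^'m"
    and H :: "real^'n \<Rightarrow> real^'m \<Rightarrow> real"
    and LF \<mu>F LG \<mu>G LStr LBil \<mu>s R \<sigma>Str \<sigma>Bil \<sigma> r \<beta> :: real
    and D\<xi> :: "'s measure" and D\<zeta> :: "'z measure"
    and nf :: "real^'n \<Rightarrow> 's \<Rightarrow> real^'n" and ng :: "real^'m \<Rightarrow> 's \<Rightarrow> real^'m"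
    and hx :: "real^'n \<Rightarrow> real^'m \<Rightarrow> 'z \<Rightarrow> real^'n"
    and hy :: "real^'n \<Rightarrow> real^'m \<Rightarrow> 'z \<Rightarrow> real^'m"
    and M :: "'w measure"
    and \<xi> :: "nat \<Rightarrow> 'w \<Rightarrow> 's" and \<zeta>h \<zeta> :: "nat \<Rightarrow> 'w \<Rightarrow> 'z"
    and \<alpha> \<eta> :: "nat \<Rightarrow> real" and T :: nat
    and x0 wx :: "real^'n" and y0 wy :: "real^'m"
    and x :: "nat \<Rightarrow> 'w \<Rightarrow> real^'n" and y :: "nat \<Rightarrow> 'w \<Rightarrow> real^'m"
  assumes dims: "CARD('m) \<le> CARD('n)"
    and \<mu>_pos: "\<mu>F > 0" "\<mu>G > 0"
    and F: "smooth_strongly_convex LF \<mu>F F"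
    and G: "smooth_strongly_convex LG \<mu>G G"
    and H: "H = bilinear_coupling B ux uy"
    and saddle: "saddle_point (\<lambda>x y. F x + H x y - G y) wx wy"
    and LStr: "LStr = max LF (\<mu>F / \<mu>G * LG) - \<mu>F"
    and LBil: "LBil = sqrt (lambda_max (transpose B ** B) * (\<mu>F / \<mu>G) + \<mu>F\<^sup>2)"
    and \<mu>s: "\<mu>s = \<mu>F"
    and R: "R = \<mu>G / \<mu>F"
    and distributions: "prob_space D\<xi>" "prob_space D\<zeta>"
    and measurable_oracles:
      "(\<lambda>(x, s). nf x s) \<in> borel_measurable (borel \<Otimes>\<^sub>M D\<xi>)"
      "(\<lambda>(y, s). ng y s) \<in> borel_measurable (borel \<Otimes>\<^sub>M D\<xi>)"
      "(\<lambda>(x, y, z). hx x y z) \<in> borel_measurable (borel \<Otimes>\<^sub>M borel \<Otimes>\<^sub>M D\<zeta>)"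
      "(\<lambda>(x, y, z). hy x y z) \<in> borel_measurable (borel \<Otimes>\<^sub>M borel \<Otimes>\<^sub>M D\<zeta>)"
    and unbiased:
      "\<And>x. has_bochner_integral D\<xi> (\<lambda>s. nf x s) (grad F x)"
      "\<And>y. has_bochner_integral D\<xi> (\<lambda>s. ng y s) (grad G y)"
      "\<And>x y. has_bochner_integral D\<zeta> (\<lambda>z. hx x y z) (grad (\<lambda>x'. H x' y) x)"
      "\<And>x y. has_bochner_integral D\<zeta> (\<lambda>z. hy x y z) (grad (\<lambda>y'. H x y') y)"
    and noise_Str:
      "\<And>x y. integrable D\<xi> (\<lambda>s. (norm (nf x s - grad F x))\<^sup>2
                                 + 1 / R * (norm (ng y s - grad G y))\<^sup>2)"
      "\<And>x y. (\<integral>s. ((norm (nf x s - grad F x))\<^sup>2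
                   + 1 / R * (norm (ng y s - grad G y))\<^sup>2) \<partial>D\<xi>) \<le> \<sigma>Str\<^sup>2"
    and noise_Bil:
      "\<And>x y. integrable D\<zeta> (\<lambda>z. (norm (hx x y z - grad (\<lambda>x'. H x' y) x))\<^sup>2
                                 + 1 / R * (norm (hy x y z - grad (\<lambda>y'. H x y') y))\<^sup>2)"
      "\<And>x y. (\<integral>z. ((norm (hx x y z - grad (\<lambda>x'. H x' y) x))\<^sup>2
                   + 1 / R * (norm (hy x y z - grad (\<lambda>y'. H x y') y))\<^sup>2) \<partial>D\<zeta>) \<le> \<sigma>Bil\<^sup>2"
    and r: "r \<in> {0<..<1}"
    and \<beta>: "\<beta> > 0"
    and \<sigma>: "\<sigma> = 1 / sqrt 3 * sqrt (1 / (1 - r) * \<sigma>Str\<^sup>2 + (2 + 1 / \<beta>) * \<sigma>Bil\<^sup>2)"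
    and \<alpha>: "\<And>t. t \<in> {1..T} \<Longrightarrow> \<alpha> t \<in> {0<..alpha_bar LStr LBil \<mu>s r \<beta>}"
    and \<eta>: "\<And>t. t \<in> {1..T} \<Longrightarrow> \<eta> t = \<alpha> t / \<mu>s"
    and prob: "prob_space M"
    and samples: "independent_samples M D\<xi> D\<zeta> T \<xi> \<zeta>h \<zeta>"
    and x: "\<And>t \<omega>. x t \<omega> =
      st_x (ageg nf ng hx hy \<mu>F \<mu>G R \<eta> \<alpha> (\<lambda>k. \<xi> k \<omega>) (\<lambda>k. \<zeta>h k \<omega>) (\<lambda>k. \<zeta> k \<omega>) x0 y0 t)"
    and y: "\<And>t \<omega>. y t \<omega> =
      st_y (ageg nf ng hx hy \<mu>F \<mu>G R \<eta> \<alpha> (\<lambda>k. \<xi> k \<omega>) (\<lambda>k. \<zeta>h k \<omega>) (\<lambda>k. \<zeta> k \<omega>) x0 y0 t)"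
  shows "\<forall>t\<in>{1..T}.
    integrable M (\<lambda>\<omega>. (norm (x t \<omega> - wx))\<^sup>2 + R * (norm (y t \<omega> - wy))\<^sup>2) \<and>
    (\<integral>\<omega>. ((norm (x t \<omega> - wx))\<^sup>2 + R * (norm (y t \<omega> - wy))\<^sup>2) \<partial>M)
      \<le> ((norm (x0 - wx))\<^sup>2 + R * (norm (y0 - wy))\<^sup>2) * (LStr / \<mu>s + 1) * (\<Prod>\<tau>=1..t. 1 - \<alpha> \<tau>)
        + 3 * \<sigma>\<^sup>2 / \<mu>s\<^sup>2 * (\<Sum>\<tau>=1..t. (\<alpha> \<tau>)\<^sup>2 * (\<Prod>\<tau>'=\<tau>+1..t. 1 - \<alpha> \<tau>'))"
proof -
  define s where "s = sqrt R"
  have R_pos: "0 < R" using \<mu>_pos by (simp add: R)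
  then have s_pos: "0 < s" and s2: "s * s = R" by (simp_all add: s_def)
  have \<mu>R: "\<mu>G = s * s * \<mu>F" using \<mu>_pos by (simp add: s2 R)
  define f where "f z = F (fst z) + G ((1 / s) *\<^sub>R snd z) - \<mu>F / 2 * (norm z)\<^sup>2"
    for z :: "(real^'n) \<times> (real^'m)"
  define g where "g z = (grad F (fst z), (1 / s) *\<^sub>R grad G ((1 / s) *\<^sub>R snd z)) - \<mu>F *\<^sub>R z"
    for z :: "(real^'n) \<times> (real^'m)"
  \<comment> \<open>The second component has the opposite sign because the second player ascends in
    the coupling; \<open>1 / s\<close> is the chain rule for the rescaling.\<close>
  define W where "W z = \<mu>F *\<^sub>R z + (B *v ((1 / s) *\<^sub>R snd z) - ux,
      - (1 / s) *\<^sub>R (transpose B *v fst z + uy))" for z :: "(real^'n) \<times> (real^'m)"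
  \<comment> \<open>The shift by \<open>\<mu>F *\<^sub>R z\<close> is subtracted in
    \<open>go\<close> and added in \<open>ho\<close>. With \<open>go\<close> taken at the middle
    point and \<open>ho\<close> at the point where the coupling is sampled, the sum reproduces the
    correction \<open>- \<mu>F *\<^sub>R (xmd - x)\<close> of the algorithm.\<close>
  define go where "go z v = (nf (fst z) v, (1 / s) *\<^sub>R ng ((1 / s) *\<^sub>R snd z) v) - \<mu>F *\<^sub>R z"
    for z :: "(real^'n) \<times> (real^'m)" and v
  define ho where "ho z v = \<mu>F *\<^sub>R z + (hx (fst z) ((1 / s) *\<^sub>R snd z) v,
      - (1 / s) *\<^sub>R hy (fst z) ((1 / s) *\<^sub>R snd z) v)" for z :: "(real^'n) \<times> (real^'m)" and v
  define zs where "zs = (wx, s *\<^sub>R wy)"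
  have norm_pair: "(norm (a, c *\<^sub>R b))\<^sup>2 = (norm a)\<^sup>2 + c\<^sup>2 * (norm b)\<^sup>2" for a :: "real^'n" and b :: "real^'m" and c
    by (simp add: norm_Pair power_mult_distrib)
  have inv_s2: "(1 / s)\<^sup>2 = 1 / R" using s_pos s2 by (simp add: power_divide power2_eq_square)
  have gradH: "grad (\<lambda>x'. H x' b) a = B *v b - ux" "grad (\<lambda>y'. H a y') b = transpose B *v a + uy" for a b
    unfolding H by (rule grad_bilinear_coupling)+
  interpret composite_operator f g W LStr LBil \<mu>s zs
    unfolding LStr LBil \<mu>s zs_def
  proof (rule composite_operator_rescaled[OF \<mu>_pos R s_def F G saddle[unfolded H]])
    fix a :: "real^'n" and b :: "real^'m"
    show "f (a, s *\<^sub>R b) = F a + G b - \<mu>F / 2 * ((norm a)\<^sup>2 + R * (norm b)\<^sup>2)"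
      using s_pos s2 by (simp add: f_def norm_pair power2_eq_square[of s])
    show "g (a, s *\<^sub>R b) = (grad F a - \<mu>F *\<^sub>R a, (1 / s) *\<^sub>R grad G b - \<mu>F *\<^sub>R s *\<^sub>R b)"
      using s_pos by (simp add: g_def)
    show "W (a, s *\<^sub>R b) = (\<mu>F *\<^sub>R a + (B *v b - ux),
        \<mu>F *\<^sub>R s *\<^sub>R b - (1 / s) *\<^sub>R (transpose B *v a + uy))"
      using s_pos by (simp add: W_def del: transpose_matrix_vector)
  qed
  have nf_compose: "(\<lambda>v. nf (a v) (b v)) \<in> borel_measurable N"
    if "a \<in> borel_measurable N" "b \<in> measurable N D\<xi>" for a b and N :: "(((real^'n) \<times> (real^'m)) \<times> 's) measure"
    using measurable_compose[OF measurable_Pair[OF that] measurable_oracles(1)] by simp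
  have ng_compose: "(\<lambda>v. ng (a v) (b v)) \<in> borel_measurable N"
    if "a \<in> borel_measurable N" "b \<in> measurable N D\<xi>" for a b and N :: "(((real^'n) \<times> (real^'m)) \<times> 's) measure"
    using measurable_compose[OF measurable_Pair[OF that] measurable_oracles(2)] by simp
  have hx_compose: "(\<lambda>v. hx (a v) (b v) (c v)) \<in> borel_measurable N"
    if "a \<in> borel_measurable N" "b \<in> borel_measurable N" "c \<in> measurable N D\<zeta>"
    for a b c and N :: "(((real^'n) \<times> (real^'m)) \<times> 'z) measure"
    using measurable_compose[OF measurable_Pair[OF that(1) measurable_Pair[OF that(2,3)]] measurable_oracles(3)] by simp
  have hy_compose: "(\<lambda>v. hy (a v) (b v) (c v)) \<in> borel_measurable N"
    if "a \<in> borel_measurable N" "b \<in> borel_measurable N" "c \<in> measurable N D\<zeta>"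
    for a b c and N :: "(((real^'n) \<times> (real^'m)) \<times> 'z) measure"
    using measurable_compose[OF measurable_Pair[OF that(1) measurable_Pair[OF that(2,3)]] measurable_oracles(4)] by simp
  \<comment> \<open>The deterministic shift cancels, and the factor \<open>1 / s\<close> on the
    second block becomes the weight \<open>1 / R\<close> of the noise assumption.\<close>
  have go_noise: "(norm (go z v - g z))\<^sup>2 = (norm (nf (fst z) v - grad F (fst z)))\<^sup>2
      + 1 / R * (norm (ng ((1 / s) *\<^sub>R snd z) v - grad G ((1 / s) *\<^sub>R snd z)))\<^sup>2" for z v
    unfolding inv_s2[symmetric] norm_pair[symmetric] by (simp add: go_def g_def scaleR_diff_right)
  have ho_noise: "(norm (ho z v - W z))\<^sup>2
      = (norm (hx (fst z) ((1 / s) *\<^sub>R snd z) v - grad (\<lambda>x'. H x' ((1 / s) *\<^sub>R snd z)) (fst z)))\<^sup>2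
      + 1 / R * (norm (hy (fst z) ((1 / s) *\<^sub>R snd z) v - grad (\<lambda>y'. H (fst z) y') ((1 / s) *\<^sub>R snd z)))\<^sup>2" for z v
  proof -
    have "ho z v - W z = (hx (fst z) ((1 / s) *\<^sub>R snd z) v - grad (\<lambda>x'. H x' ((1 / s) *\<^sub>R snd z)) (fst z),
        (- 1 / s) *\<^sub>R (hy (fst z) ((1 / s) *\<^sub>R snd z) v - grad (\<lambda>y'. H (fst z) y') ((1 / s) *\<^sub>R snd z)))"
      by (simp add: ho_def W_def gradH scaleR_diff_right del: transpose_matrix_vector)
    moreover have "(- 1 / s)\<^sup>2 = 1 / R" using inv_s2 by (simp add: power_divide)
    ultimately show ?thesis by (simp only: norm_pair)
  qed
  have pair_integral: "has_bochner_integral D (\<lambda>v. (X v, Y v)) (a, b)"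
    if "has_bochner_integral D X a" "has_bochner_integral D Y b"
    for D :: "'v measure" and X :: "'v \<Rightarrow> real^'n" and Y :: "'v \<Rightarrow> real^'m" and a b
  proof -
    have "has_bochner_integral D (\<lambda>v. (X v, 0) + (0, Y v)) ((a, 0) + (0, b))"
      by (intro has_bochner_integral_add
          has_bochner_integral_bounded_linear[OF _ that(1)] has_bochner_integral_bounded_linear[OF _ that(2)]
          bounded_linear_Pair bounded_linear_ident bounded_linear_zero)
    then show ?thesis by simp
  qed
  have const_integral: "has_bochner_integral D (\<lambda>_. a) a" if "prob_space D"
    for D :: "'v measure" and a :: "(real^'n) \<times> (real^'m)"
  proof -
    interpret prob_space D by (rule that)
    show ?thesis by (simp add: has_bochner_integral_iff prob_space)
  qed
  interpret stochastic_ageg f g W LStr LBil \<mu>s zs D\<xi> D\<zeta> go ho "\<sigma>Str\<^sup>2" "\<sigma>Bil\<^sup>2"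
  proof (intro stochastic_ageg.intro stochastic_ageg_axioms.intro)
    show "composite_operator f g W LStr LBil \<mu>s zs" by (rule composite_operator_axioms)
    show "prob_space D\<xi>" "prob_space D\<zeta>" by (fact distributions)+
    have m1: "(\<lambda>q :: ((real^'n) \<times> (real^'m)) \<times> 's. fst (fst q)) \<in> borel_measurable (borel \<Otimes>\<^sub>M D\<xi>)"
      "(\<lambda>q :: ((real^'n) \<times> (real^'m)) \<times> 's. snd (fst q)) \<in> borel_measurable (borel \<Otimes>\<^sub>M D\<xi>)"
      "(\<lambda>q :: ((real^'n) \<times> (real^'m)) \<times> 's. fst q) \<in> borel_measurable (borel \<Otimes>\<^sub>M D\<xi>)"
      by (auto simp: borel_prod[symmetric])
    have m2: "(\<lambda>q :: ((real^'n) \<times> (real^'m)) \<times> 'z. fst (fst q)) \<in> borel_measurable (borel \<Otimes>\<^sub>M D\<zeta>)"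
      "(\<lambda>q :: ((real^'n) \<times> (real^'m)) \<times> 'z. snd (fst q)) \<in> borel_measurable (borel \<Otimes>\<^sub>M D\<zeta>)"
      "(\<lambda>q :: ((real^'n) \<times> (real^'m)) \<times> 'z. fst q) \<in> borel_measurable (borel \<Otimes>\<^sub>M D\<zeta>)"
      by (auto simp: borel_prod[symmetric])
    show "(\<lambda>(z, v). go z v) \<in> borel_measurable (borel \<Otimes>\<^sub>M D\<xi>)"
      unfolding go_def case_prod_beta
      by (intro borel_measurable_diff borel_measurable_Pair borel_measurable_scaleR nf_compose ng_compose m1
          measurable_snd borel_measurable_const)
    show "(\<lambda>(z, v). ho z v) \<in> borel_measurable (borel \<Otimes>\<^sub>M D\<zeta>)"
      unfolding ho_def case_prod_beta
      by (intro borel_measurable_add borel_measurable_Pair borel_measurable_scaleR hx_compose hy_compose m2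
          measurable_snd borel_measurable_const)
    have "F differentiable_on UNIV" "G differentiable_on UNIV"
      using F G by (simp_all add: smooth_strongly_convex_def differentiable_on_def)
    then have "continuous_on UNIV F" "continuous_on UNIV G"
      by (simp_all add: differentiable_imp_continuous_on)
    note cont = this[THEN continuous_on_compose2]
    show "f \<in> borel_measurable borel"
      unfolding f_def[abs_def]
      by (intro borel_measurable_continuous_onI continuous_intros cont) auto
    fix z
    show "has_bochner_integral D\<xi> (go z) (g z)"
      unfolding go_def[abs_def] g_def
      by (intro has_bochner_integral_diff pair_integral has_bochner_integral_scaleR_right unbiased
          const_integral distributions)
    show "has_bochner_integral D\<zeta> (ho z) (W z)"
      unfolding ho_def[abs_def] W_def
      by (intro has_bochner_integral_add pair_integral has_bochner_integral_scaleR_right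
          unbiased(3,4)[unfolded gradH]
          const_integral distributions)
    show "integrable D\<xi> (\<lambda>v. (norm (go z v - g z))\<^sup>2)" "(\<integral>v. (norm (go z v - g z))\<^sup>2 \<partial>D\<xi>) \<le> \<sigma>Str\<^sup>2"
      unfolding go_noise by (rule noise_Str)+
    show "integrable D\<zeta> (\<lambda>v. (norm (ho z v - W z))\<^sup>2)" "(\<integral>v. (norm (ho z v - W z))\<^sup>2 \<partial>D\<zeta>) \<le> \<sigma>Bil\<^sup>2"
      unfolding ho_noise by (rule noise_Bil)+
  qed
  define S where "S \<omega> = ageg nf ng hx hy \<mu>F \<mu>G R \<eta> \<alpha> (\<lambda>k. \<xi> k \<omega>) (\<lambda>k. \<zeta>h k \<omega>) (\<lambda>k. \<zeta> k \<omega>) x0 y0" for \<omega>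
  define Z where "Z k \<omega> = ((st_x (S \<omega> k), s *\<^sub>R st_y (S \<omega> k)), (st_xag (S \<omega> k), s *\<^sub>R st_yag (S \<omega> k)))" for k \<omega>
  \<comment> \<open>Restricted to \<open>k < T\<close> because \<open>\<eta>\<close> is tied to
    \<open>\<alpha>\<close> only on \<open>{1..T}\<close>. The weight
    \<open>\<alpha> (Suc (Suc k))\<close> in the algorithm's step affects only the stored middle
    points, hence no component of \<open>Z\<close>.\<close>
  have Z_Suc: "Z (Suc k) \<omega> = step (\<alpha> (Suc k)) (Z k \<omega>) (\<xi> (Suc k) \<omega>) (\<zeta>h (Suc k) \<omega>) (\<zeta> (Suc k) \<omega>)"
    if "k < T" for k \<omega>
  proof -
    define a where "a = \<alpha> (Suc k)"
    have \<eta>k: "\<eta> (Suc k) = a / \<mu>F" using \<eta>[of "Suc k"] that by (simp add: a_def \<mu>s)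
    define \<eta>' where "\<eta>' = a / \<mu>F"
    define u v u' v' where "u = st_x (S \<omega> k)" and "v = st_y (S \<omega> k)"
      and "u' = st_xag (S \<omega> k)" and "v' = st_yag (S \<omega> k)"
    define um vm where "um = (1 - a) *\<^sub>R u' + a *\<^sub>R u" and "vm = (1 - a) *\<^sub>R v' + a *\<^sub>R v"
    define uh vh where "uh = u - \<eta>' *\<^sub>R (nf um (\<xi> (Suc k) \<omega>) + hx u v (\<zeta>h (Suc k) \<omega>) - \<mu>F *\<^sub>R (um - u))"
      and "vh = v - (\<eta>' / R) *\<^sub>R (- hy u v (\<zeta>h (Suc k) \<omega>) + ng vm (\<xi> (Suc k) \<omega>) - \<mu>G *\<^sub>R (vm - v))"
    have md: "(1 - a) *\<^sub>R (u', s *\<^sub>R v') + a *\<^sub>R (u, s *\<^sub>R v) = (um, s *\<^sub>R vm)"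
      by (simp add: um_def vm_def algebra_simps)
    \<comment> \<open>Half step and full step share this form and differ only in the point
      \<open>(p, q)\<close> at which the coupling is evaluated. In the second block
      \<open>\<eta>' / s = s * (\<eta>' / R)\<close>, which produces the stepsize
      \<open>\<eta>' / R\<close> in the original coordinates.\<close>
    have descent: "(u, s *\<^sub>R v) - \<eta>' *\<^sub>R (go (um, s *\<^sub>R vm) t + ho (p, s *\<^sub>R q) t')
        = (u - \<eta>' *\<^sub>R (nf um t + hx p q t' - \<mu>F *\<^sub>R (um - p)),
           s *\<^sub>R (v - (\<eta>' / R) *\<^sub>R (- hy p q t' + ng vm t - \<mu>G *\<^sub>R (vm - q))))" for p q t t'
      using s_pos by (simp add: go_def ho_def \<mu>R s2[symmetric] algebra_simps)
    have step_eq: "step a ((u, s *\<^sub>R v), (u', s *\<^sub>R v')) (\<xi> (Suc k) \<omega>) (\<zeta>h (Suc k) \<omega>) (\<zeta> (Suc k) \<omega>)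
      = ((u - \<eta>' *\<^sub>R (nf um (\<xi> (Suc k) \<omega>) + hx uh vh (\<zeta> (Suc k) \<omega>) - \<mu>F *\<^sub>R (um - uh)),
          s *\<^sub>R (v - (\<eta>' / R) *\<^sub>R (- hy uh vh (\<zeta> (Suc k) \<omega>) + ng vm (\<xi> (Suc k) \<omega>) - \<mu>G *\<^sub>R (vm - vh)))),
         ((1 - a) *\<^sub>R u' + a *\<^sub>R uh, s *\<^sub>R ((1 - a) *\<^sub>R v' + a *\<^sub>R vh)))"
      unfolding step_def Let_def fst_conv snd_conv md
      unfolding \<mu>s \<eta>'_def[symmetric] descent uh_def[symmetric] vh_def[symmetric]
      by (simp add: algebra_simps)
    have S_Suc: "S \<omega> (Suc k) = ageg_step nf ng hx hy \<mu>F \<mu>G R \<eta>' a (\<alpha> (Suc (Suc k)))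
        (\<xi> (Suc k) \<omega>) (\<zeta>h (Suc k) \<omega>) (\<zeta> (Suc k) \<omega>) (S \<omega> k)"
      by (simp add: S_def \<eta>k \<eta>'_def a_def)
    have S_md: "st_xmd (S \<omega> k) = um" "st_ymd (S \<omega> k) = vm"
      unfolding S_def ageg_md by (simp_all add: um_def vm_def u_def v_def u'_def v'_def a_def S_def)
    have Zk: "Z k \<omega> = ((u, s *\<^sub>R v), (u', s *\<^sub>R v'))"
      by (simp add: Z_def u_def v_def u'_def v'_def)
    show ?thesis
      unfolding a_def[symmetric] Zk step_eq Z_def[of "Suc k"] S_Suc
      by (simp add: ageg_step_def Let_def S_md uh_def vh_def u_def v_def u'_def v'_def)
  qed
  have dist: "(norm (fst (Z k \<omega>) - zs))\<^sup>2 = (norm (x k \<omega> - wx))\<^sup>2 + R * (norm (y k \<omega> - wy))\<^sup>2" for k \<omega>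
  proof -
    have "fst (Z k \<omega>) - zs = (x k \<omega> - wx, s *\<^sub>R (y k \<omega> - wy))"
      by (simp add: Z_def S_def x y zs_def scaleR_diff_right)
    then show ?thesis using s2 by (simp add: norm_pair power2_eq_square[of s])
  qed
  define p0 where "p0 = ((x0, s *\<^sub>R y0), (x0, s *\<^sub>R y0))"
  have Z_0: "Z 0 \<omega> = p0" for \<omega> by (simp add: Z_def S_def p0_def)
  let ?\<kappa> = "LStr / \<mu>s + (1 + \<beta>) * LBil\<^sup>2 / \<mu>s\<^sup>2"
  have LStr_nonneg: "0 \<le> LStr" using smooth_strongly_convex_le[OF F] by (simp add: LStr)
  then have \<kappa>: "0 \<le> ?\<kappa>" using \<beta> \<mu>_pos by (simp add: \<mu>s)
  have steps: "0 < \<alpha> k \<and> \<alpha> k \<le> 1 \<and> (\<alpha> k)\<^sup>2 * ?\<kappa> + 2 * \<alpha> k \<le> r" if "k \<in> {1..T}" for k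
  proof -
    have *: "0 < \<alpha> k" "\<alpha> k \<le> r / (1 + sqrt (1 + r * ?\<kappa>))"
      using \<alpha>[OF that] by (auto simp: alpha_bar_def)
    have "(\<alpha> k)\<^sup>2 * ?\<kappa> + 2 * \<alpha> k \<le> r" using r by (intro stepsize_condition \<kappa> *) auto
    moreover have "0 \<le> (\<alpha> k)\<^sup>2 * ?\<kappa>" using \<kappa> by simp
    ultimately show ?thesis using * r by auto
  qed
  \<comment> \<open>The aggregate starts at the initial point itself, so smoothness bounds its
    Bregman term by \<open>LStr / \<mu>s\<close> times the same squared distance.\<close>
  have init: "lyap p0 \<le> ((norm (x0 - wx))\<^sup>2 + R * (norm (y0 - wy))\<^sup>2) * (LStr / \<mu>s + 1)"
  proof -
    have d0: "(norm ((x0, s *\<^sub>R y0) - zs))\<^sup>2 = (norm (x0 - wx))\<^sup>2 + R * (norm (y0 - wy))\<^sup>2"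
      using dist[of 0] by (simp add: Z_def S_def x y)
    have "2 / \<mu>s * breg (x0, s *\<^sub>R y0) \<le> 2 / \<mu>s * (LStr / 2 * (norm ((x0, s *\<^sub>R y0) - zs))\<^sup>2)"
      using f_smooth[of "(x0, s *\<^sub>R y0)" zs] \<mu>_pos unfolding breg_def \<mu>s
      by (intro mult_left_mono) auto
    then show ?thesis
      unfolding d0[symmetric] lyap_def p0_def by (simp add: algebra_simps)
  qed
  have \<sigma>2: "\<sigma>Str\<^sup>2 / (1 - r) + (2 + 1 / \<beta>) * \<sigma>Bil\<^sup>2 = 3 * \<sigma>\<^sup>2"
    using r \<beta> by (simp add: \<sigma> power_mult_distrib power_divide)
  show ?thesis
  proof
    fix t assume t: "t \<in> {1..T}"
    have \<alpha>_le: "\<And>k. k \<in> {1..t} \<Longrightarrow> \<alpha> k \<le> 1" using steps t by auto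
    have "0 < r" "r < 1" "t \<le> T" using r t by auto
    note bound = expected_lyap_bound[OF prob samples Z_0 Z_Suc \<open>0 < r\<close> \<open>r < 1\<close> \<beta> steps \<open>t \<le> T\<close>]
    note [measurable] = bound(1)
    \<comment> \<open>The squared distance is dominated by the integrable \<open>lyap\<close>, from
      which it inherits integrability.\<close>
    have int: "integrable M (\<lambda>\<omega>. (norm (fst (Z t \<omega>) - zs))\<^sup>2)"
      by (rule Bochner_Integration.integrable_bound[OF bound(2)]) (auto simp: lyap_ge lyap_nonneg)
    have "(\<integral>\<omega>. (norm (fst (Z t \<omega>) - zs))\<^sup>2 \<partial>M) \<le> (\<integral>\<omega>. lyap (Z t \<omega>) \<partial>M)"
      by (rule integral_mono[OF int bound(2) lyap_ge])
    also note bound(3)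
    also have "lyap p0 * (\<Prod>\<tau>=1..t. 1 - \<alpha> \<tau>)
        \<le> ((norm (x0 - wx))\<^sup>2 + R * (norm (y0 - wy))\<^sup>2) * (LStr / \<mu>s + 1) * (\<Prod>\<tau>=1..t. 1 - \<alpha> \<tau>)"
      using \<alpha>_le by (intro mult_right_mono init prod_nonneg) auto
    finally show "integrable M (\<lambda>\<omega>. (norm (x t \<omega> - wx))\<^sup>2 + R * (norm (y t \<omega> - wy))\<^sup>2) \<and>
      (\<integral>\<omega>. ((norm (x t \<omega> - wx))\<^sup>2 + R * (norm (y t \<omega> - wy))\<^sup>2) \<partial>M)
        \<le> ((norm (x0 - wx))\<^sup>2 + R * (norm (y0 - wy))\<^sup>2) * (LStr / \<mu>s + 1) * (\<Prod>\<tau>=1..t. 1 - \<alpha> \<tau>)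
        + 3 * \<sigma>\<^sup>2 / \<mu>s\<^sup>2 * (\<Sum>\<tau>=1..t. (\<alpha> \<tau>)\<^sup>2 * (\<Prod>\<tau>'=\<tau>+1..t. 1 - \<alpha> \<tau>'))"
      using int unfolding dist \<sigma>2 by simp
  qed
qed

end
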